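(* Let $H_0$ be a selfadjoint operator in $\mathcal H$ with $\sigma(H_0)\subset[0,\infty)$. Let $H$ be a closed operator in $\mathcal H$ and assume that $a\in\rho(H)\cap(-\infty,0)$. If $R_H(a)-R_{H_0}(a)\in\mathcal S_p(\mathcal H)$ for some $p\ge1$, then $$\sum_{\lambda\in\sigma_d(H)}\frac{\operatorname{dist}(\lambda,[0,\infty))^p}{|\lambda-a|^p(|\lambda|+|a|)^p}\le8^p\,\|R_H(a)-R_{H_0}(a)\|_{\mathcal S_p}^p .$$
   Context: $\mathcal H$ is a complex separable Hilbert space, $\rho(Z)$ the resolvent set and $R_Z(\lambda)=(\lambda-Z)^{-1}$ the resolvent of a closed operator $Z$. $\mathcal S_p(\mathcal H)$ is the Schatten class of order $p$, with norm $\|K\|_{\mathcal S_p}=(\sum_ns_n(K)^p)^{1/p}$, $s_n(K)$ being the singular values. A discrete eigenvalue of a closed operator $Z$ is an isolated point $\lambda$ of $\sigma(Z)$ such that the Riesz projection $P_Z(\lambda)=\frac1{2\pi i}\oint R_Z(\mu)d\mu$ (over a small counterclockwise circle around $\lambda$) has finite rank; this rank is the algebraic multiplicity. $\sigma_d(Z)$ is the set of discrete eigenvalues. In sums over $\sigma_d(Z)$ each eigenvalue is counted according to its algebraic multiplicity. *)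

theory Defs
  imports "HOL-Complex_Analysis.Complex_Analysis"
begin

section \<open>Complex Hilbert spaces\<close>

text \<open>The inner product is linear in its first argument. Positivity, definiteness and
  \<open>1 *\<^sub>C x = x\<close> follow from the axioms given here and those of \<^class>\<open>banach\<close>.
  Separability is not part of the class.\<close>

class complex_hilbert_space = banach +
  fixes scaleC :: "complex \<Rightarrow> 'a \<Rightarrow> 'a" (infixr \<open>*\<^sub>C\<close> 75)
    and cinner :: "'a \<Rightarrow> 'a \<Rightarrow> complex"
  assumes scaleR_eq_scaleC: "scaleR r x = complex_of_real r *\<^sub>C x"
    and scaleC_add_right: "c *\<^sub>C (x + y) = c *\<^sub>C x + c *\<^sub>C y"
    and scaleC_add_left: "(c + d) *\<^sub>C x = c *\<^sub>C x + d *\<^sub>C x"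
    and scaleC_scaleC: "c *\<^sub>C d *\<^sub>C x = (c * d) *\<^sub>C x"
    and cinner_commute: "cinner x y = cnj (cinner y x)"
    and cinner_add_left: "cinner (x + y) z = cinner x z + cinner y z"
    and cinner_scaleC_left: "cinner (c *\<^sub>C x) y = c * cinner x y"
    and cinner_self: "cinner x x = complex_of_real ((norm x)\<^sup>2)"

lemma scaleC_one: "1 *\<^sub>C x = (x :: 'a :: complex_hilbert_space)"
  using scaleR_eq_scaleC[of 1 x] by simp

global_interpretation complex_vector:
  vector_space "scaleC :: complex \<Rightarrow> 'a \<Rightarrow> 'a :: complex_hilbert_space"
  defines csubspace = complex_vector.subspace
    and cspan = complex_vector.span
    and cdim = complex_vector.dim
  by unfold_locales
    (simp_all add: scaleC_add_right scaleC_add_left scaleC_scaleC scaleC_one)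

abbreviation clinear ::
    "('a :: complex_hilbert_space \<Rightarrow> 'b :: complex_hilbert_space) \<Rightarrow> bool"
  where "clinear \<equiv> Vector_Spaces.linear scaleC scaleC"


section \<open>Unbounded operators\<close>

text \<open>The values of \<open>op_fun Z\<close> outside \<open>op_dom Z\<close> are irrelevant.\<close>

record 'a unbounded_op =
  op_dom :: "'a set"
  op_fun :: "'a \<Rightarrow> 'a"

definition op_graph :: "'a unbounded_op \<Rightarrow> ('a \<times> 'a) set"
  where "op_graph Z = {(x, op_fun Z x) | x. x \<in> op_dom Z}"

definition linear_op :: "'a :: complex_hilbert_space unbounded_op \<Rightarrow> bool"
  where "linear_op Z \<longleftrightarrow> csubspace (op_dom Z) \<and>
    (\<forall>x\<in>op_dom Z. \<forall>y\<in>op_dom Z. op_fun Z (x + y) = op_fun Z x + op_fun Z y) \<and>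
    (\<forall>c. \<forall>x\<in>op_dom Z. op_fun Z (c *\<^sub>C x) = c *\<^sub>C op_fun Z x)"

definition closed_op :: "'a :: complex_hilbert_space unbounded_op \<Rightarrow> bool"
  where "closed_op Z \<longleftrightarrow> linear_op Z \<and> closed (op_graph Z)"

text \<open>The adjoint is meaningful only for densely defined operators.\<close>

definition adjoint_op :: "'a :: complex_hilbert_space unbounded_op \<Rightarrow> 'a unbounded_op"
  where "adjoint_op Z =
    \<lparr>op_dom = {y. \<exists>z. \<forall>x\<in>op_dom Z. cinner (op_fun Z x) y = cinner x z},
     op_fun = (\<lambda>y. THE z. \<forall>x\<in>op_dom Z. cinner (op_fun Z x) y = cinner x z)\<rparr>"

definition selfadjoint_op :: "'a :: complex_hilbert_space unbounded_op \<Rightarrow> bool"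
  where "selfadjoint_op Z \<longleftrightarrow>
    linear_op Z \<and> closure (op_dom Z) = UNIV \<and> op_graph (adjoint_op Z) = op_graph Z"


section \<open>Resolvent and discrete spectrum\<close>

definition resolvent :: "'a :: complex_hilbert_space unbounded_op \<Rightarrow> complex \<Rightarrow> 'a \<Rightarrow> 'a"
  where "resolvent Z z = inv_into (op_dom Z) (\<lambda>x. z *\<^sub>C x - op_fun Z x)"

definition resolvent_set :: "'a :: complex_hilbert_space unbounded_op \<Rightarrow> complex set"
  where "resolvent_set Z = {z.
    bij_betw (\<lambda>x. z *\<^sub>C x - op_fun Z x) (op_dom Z) UNIV \<and> bounded_linear (resolvent Z z)}"

definition spectrum :: "'a :: complex_hilbert_space unbounded_op \<Rightarrow> complex set"
  where "spectrum Z = - resolvent_set Z"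

text \<open>The integral is taken in the operator norm. The library's contour integral is restricted
  to complex-valued integrands; this is the same formula for operator-valued ones.\<close>

definition op_contour_integral ::
    "(real \<Rightarrow> complex) \<Rightarrow> (complex \<Rightarrow> 'a \<Rightarrow> 'a :: complex_hilbert_space) \<Rightarrow> 'a \<Rightarrow>\<^sub>L 'a"
  where "op_contour_integral \<gamma> F =
    integral {0..1} (\<lambda>t. Blinfun (\<lambda>x. vector_derivative \<gamma> (at t within {0..1}) *\<^sub>C F (\<gamma> t) x))"

text \<open>For an isolated point of the spectrum, the value does not depend on the choice of
  the admissible radius.\<close>

definition riesz_projection ::
    "'a :: complex_hilbert_space unbounded_op \<Rightarrow> complex \<Rightarrow> 'a \<Rightarrow> 'a"
  where "riesz_projection Z z = (let r = SOME r. r > 0 \<and> cball z r \<inter> spectrum Z = {z} in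
    (\<lambda>x. (1 / (2 * complex_of_real pi * \<i>)) *\<^sub>C
      blinfun_apply (op_contour_integral (circlepath z r) (resolvent Z)) x))"

definition discrete_spectrum :: "'a :: complex_hilbert_space unbounded_op \<Rightarrow> complex set"
  where "discrete_spectrum Z = {z. z isolated_in spectrum Z \<and>
    (\<exists>B. finite B \<and> range (riesz_projection Z z) \<subseteq> cspan B)}"

definition alg_multiplicity :: "'a :: complex_hilbert_space unbounded_op \<Rightarrow> complex \<Rightarrow> nat"
  where "alg_multiplicity Z z = cdim (range (riesz_projection Z z))"


section \<open>Schatten classes\<close>

definition compact_op :: "('a :: complex_hilbert_space \<Rightarrow> 'a) \<Rightarrow> bool"
  where "compact_op K \<longleftrightarrow> clinear K \<and> compact (closure (K ` cball 0 1))"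

definition bounded_adjoint :: "('a :: complex_hilbert_space \<Rightarrow> 'a) \<Rightarrow> 'a \<Rightarrow> 'a"
  where "bounded_adjoint K = op_fun (adjoint_op \<lparr>op_dom = UNIV, op_fun = K\<rparr>)"

text \<open>For compact \<open>K\<close>, the singular values are the square roots of the eigenvalues of
  \<open>K\<^sup>* K\<close>, in decreasing order and repeated according to multiplicity, followed by zeros if
  there are only finitely many positive ones. Only the positive singular values are counted,
  since the kernel of \<open>K\<close> may have any dimension.\<close>

definition singular_value :: "('a :: complex_hilbert_space \<Rightarrow> 'a) \<Rightarrow> nat \<Rightarrow> real"
  where "singular_value K = (THE s. decseq s \<and> (\<forall>n. 0 \<le> s n) \<and>
    (\<forall>t>0. finite {n. s n = t} \<and>
      card {n. s n = t} = cdim {x. bounded_adjoint K (K x) = complex_of_real (t\<^sup>2) *\<^sub>C x}))"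

definition schatten_class :: "real \<Rightarrow> ('a :: complex_hilbert_space \<Rightarrow> 'a) set"
  where "schatten_class p =
    {K. compact_op K \<and> summable (\<lambda>n. singular_value K n powr p)}"

definition schatten_norm :: "real \<Rightarrow> ('a :: complex_hilbert_space \<Rightarrow> 'a) \<Rightarrow> real"
  where "schatten_norm p K = (\<Sum>n. singular_value K n powr p) powr (1 / p)"

end

theory Submission
  imports Defs "HOL-Computational_Algebra.Fundamental_Theorem_Algebra"
begin

text \<open>Write \<open>A\<close> for the resolvent of \<open>H\<^sub>0\<close> at \<open>a\<close>, \<open>B\<close> for that of \<open>H\<close>, and \<open>K = B - A\<close>. A discrete
  eigenvalue \<open>\<lambda>\<close> of \<open>H\<close> of multiplicity \<open>m\<close> becomes the eigenvalue \<open>1/(a - \<lambda>)\<close> of \<open>B\<close>, with an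
  \<open>m\<close>-dimensional space of generalised eigenvectors, namely the range of the Riesz projection. For
  finitely many eigenvalues, Schur's triangularisation of \<open>B\<close> on the span of these ranges gives an
  orthonormal system of vectors \<open>e\<close> whose diagonal entries \<open>\<langle>B e, e\<rangle>\<close> contain every \<open>1/(a - \<lambda>)\<close> at
  least as often as its multiplicity (\<open>multiplicity_le_diagonal_count\<close>).

  The number \<open>\<langle>A e, e\<rangle>\<close> lies in the numerical range of \<open>A\<close>, which is contained in the interval
  \<open>[1/a, 0]\<close> because \<open>H\<^sub>0\<close> is selfadjoint with spectrum in \<open>[0, \<infinity>)\<close>
  (\<open>resolvent_numerical_range\<close>). As \<open>\<langle>K e, e\<rangle> = 1/(a - \<lambda>) - \<langle>A e, e\<rangle>\<close>, the distance of
  \<open>1/(a - \<lambda>)\<close> to that interval is at most \<open>\<bar>\<langle>K e, e\<rangle>\<bar>\<close>. The map \<open>\<lambda> \<mapsto> 1/(a - \<lambda>)\<close> takes \<open>[0, \<infinity>)\<close> into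
  the interval, and comparing distances (\<open>dist_resolvent_point_lower_bound\<close>) bounds the summand
  for \<open>\<lambda>\<close> by \<open>(2 \<bar>\<langle>K e, e\<rangle>\<bar>)\<^sup>p\<close>. Finally the diagonal of \<open>K\<close> with
  respect to any orthonormal system is dominated in \<open>\<ell>\<^sup>p\<close> by the singular values
  (\<open>sum_diagonal_powr_le_schatten\<close>).

  This last step rests on the Schmidt expansion of a compact operator (\<open>singular_system\<close>), which
  also shows that \<open>singular_value\<close> is the sequence it is meant to be. That the range of the Riesz
  projection carries no other eigenvalue of \<open>B\<close> uses that the projection is idempotent, which is
  proved with two concentric circles (\<open>riesz_idempotent\<close>).\<close>

section \<open>Geometry of the complex inner product\<close>

lemma cinner_add_right: "cinner x (y + z) = cinner x y + cinner (x :: 'a :: complex_hilbert_space) z"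
  by (metis cinner_commute cinner_add_left complex_cnj_add)

lemma cinner_scaleC_right: "cinner x (c *\<^sub>C y) = cnj c * cinner (x :: 'a :: complex_hilbert_space) y"
  by (metis cinner_commute cinner_scaleC_left complex_cnj_mult)

lemma cinner_zero_left [simp]: "cinner 0 (x :: 'a :: complex_hilbert_space) = 0"
  using cinner_add_left[of 0 0 x] by simp

lemma cinner_zero_right [simp]: "cinner (x :: 'a :: complex_hilbert_space) 0 = 0"
  using cinner_add_right[of x 0 0] by simp

lemma cinner_minus_left: "cinner (- x) y = - cinner (x :: 'a :: complex_hilbert_space) y"
  using cinner_add_left[of "-x" x y] by (simp add: eq_neg_iff_add_eq_0)

lemma cinner_minus_right: "cinner x (- y) = - cinner (x :: 'a :: complex_hilbert_space) y"
  using cinner_add_right[of x "-y" y] by (simp add: eq_neg_iff_add_eq_0)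

lemma cinner_diff_left: "cinner (x - y) z = cinner x z - cinner (y :: 'a :: complex_hilbert_space) z"
  using cinner_add_left[of x "-y" z] by (simp add: cinner_minus_left)

lemma cinner_diff_right: "cinner z (x - y) = cinner z x - cinner z (y :: 'a :: complex_hilbert_space)"
  using cinner_add_right[of z x "-y"] by (simp add: cinner_minus_right)

lemma cinner_sum_left:
  "cinner (\<Sum>i\<in>I. f i) y = (\<Sum>i\<in>I. cinner (f i) (y :: 'a :: complex_hilbert_space))"
  by (induction I rule: infinite_finite_induct) (auto simp: cinner_add_left)

lemma cinner_eq_zero_commute: "cinner x y = 0 \<longleftrightarrow> cinner y (x :: 'a :: complex_hilbert_space) = 0"
  by (metis cinner_commute complex_cnj_zero)

lemma Re_cinner_commute: "Re (cinner x y) = Re (cinner y (x :: 'a :: complex_hilbert_space))"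
  by (metis cinner_commute complex_cnj(1) complex.sel(1) complex_surj)

lemma norm_sq_eq_Re_cinner: "(norm (x :: 'a :: complex_hilbert_space))\<^sup>2 = Re (cinner x x)"
  by (simp add: cinner_self)

lemma norm_scaleC: "norm (c *\<^sub>C (x :: 'a :: complex_hilbert_space)) = cmod c * norm x"
proof -
  have "complex_of_real ((norm (c *\<^sub>C x))\<^sup>2) = c * cnj c * complex_of_real ((norm x)\<^sup>2)"
    by (simp only: cinner_self[symmetric] cinner_scaleC_left cinner_scaleC_right) simp
  also have "\<dots> = complex_of_real ((cmod c * norm x)\<^sup>2)"
    by (simp add: complex_norm_square[symmetric] power_mult_distrib)
  finally have "(norm (c *\<^sub>C x))\<^sup>2 = (cmod c * norm x)\<^sup>2"
    using of_real_eq_iff by blast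
  then show ?thesis
    by (simp add: power2_eq_iff_nonneg)
qed

lemma norm_sq_diff:
  "(norm (x - y))\<^sup>2 = (norm x)\<^sup>2 - 2 * Re (cinner x y) + (norm (y :: 'a :: complex_hilbert_space))\<^sup>2"
  using Re_cinner_commute[of x y]
  by (simp add: norm_sq_eq_Re_cinner cinner_diff_left cinner_diff_right)

lemma norm_sq_add:
  "(norm (x + y))\<^sup>2 = (norm x)\<^sup>2 + 2 * Re (cinner x y) + (norm (y :: 'a :: complex_hilbert_space))\<^sup>2"
  using Re_cinner_commute[of x y]
  by (simp add: norm_sq_eq_Re_cinner cinner_add_left cinner_add_right)

lemma cauchy_schwarz: "cmod (cinner x y) \<le> norm x * norm (y :: 'a :: complex_hilbert_space)"
proof (cases "y = 0")
  case False
  then have pos: "0 < (norm y)\<^sup>2" by simp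
  define c where "c = cinner x y / (norm y)\<^sup>2"
  have "cinner x (c *\<^sub>C y) = complex_of_real ((cmod (cinner x y))\<^sup>2 / (norm y)\<^sup>2)"
    by (simp add: c_def cinner_scaleC_right complex_norm_square[symmetric] mult.commute
        del: of_real_power)
  moreover have "norm (c *\<^sub>C y) = cmod (cinner x y) / norm y"
    using False by (simp add: norm_scaleC c_def norm_divide norm_mult power2_eq_square)
  then have "(norm (c *\<^sub>C y))\<^sup>2 = (cmod (cinner x y))\<^sup>2 / (norm y)\<^sup>2"
    by (simp add: power_divide)
  ultimately have "(norm (x - c *\<^sub>C y))\<^sup>2 = (norm x)\<^sup>2 - (cmod (cinner x y))\<^sup>2 / (norm y)\<^sup>2"
    by (simp add: norm_sq_diff del: of_real_power of_real_divide)
  then have "(cmod (cinner x y))\<^sup>2 / (norm y)\<^sup>2 \<le> (norm x)\<^sup>2"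
    by (metis diff_ge_0_iff_ge zero_le_power2)
  then have "(cmod (cinner x y))\<^sup>2 \<le> (norm x * norm y)\<^sup>2"
    using pos by (simp add: divide_le_eq power_mult_distrib)
  then show ?thesis
    by (rule power2_le_imp_le) simp
qed simp

lemma bounded_linear_cinner_left:
  "bounded_linear (\<lambda>x. cinner x (y :: 'a :: complex_hilbert_space))"
proof (rule bounded_linear_intro[where K = "norm y"])
  show "cinner (r *\<^sub>R x) y = r *\<^sub>R cinner x y" for r and x :: 'a
    by (simp add: scaleR_eq_scaleC cinner_scaleC_left scaleR_conv_of_real)
qed (auto simp: cinner_add_left cauchy_schwarz)

lemma bounded_linear_scaleC: "bounded_linear (\<lambda>x. c *\<^sub>C (x :: 'a :: complex_hilbert_space))"
proof (rule bounded_linear_intro[where K = "cmod c"])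
  show "c *\<^sub>C r *\<^sub>R x = r *\<^sub>R c *\<^sub>C x" for r and x :: 'a
    by (simp add: scaleR_eq_scaleC scaleC_scaleC mult.commute)
qed (auto simp: scaleC_add_right norm_scaleC mult.commute)

lemma vector_eq_by_cinner:
  assumes "\<And>z. cinner x z = cinner y (z :: 'a :: complex_hilbert_space)"
  shows "x = y"
proof -
  have "cinner (x - y) (x - y) = 0"
    using assms[of "x - y"] by (simp add: cinner_diff_left)
  then show ?thesis
    by (simp add: cinner_self)
qed

lemma clinear_bounded_imp_bounded_linear:
  assumes "clinear (T :: 'a :: complex_hilbert_space \<Rightarrow> 'a)" "\<And>x. norm (T x) \<le> norm x * M"
  shows "bounded_linear T"
proof (rule bounded_linear_intro[OF _ _ assms(2)])
  interpret Vector_Spaces.linear scaleC scaleC T by fact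
  show "T (x + y) = T x + T y" for x y by (rule add)
  show "T (r *\<^sub>R x) = r *\<^sub>R T x" for r x by (simp add: scaleR_eq_scaleC scale)
qed

lemma clinearI:
  assumes "\<And>x y. T (x + y) = T x + T y" "\<And>c x. T (c *\<^sub>C x) = c *\<^sub>C T x"
  shows "clinear (T :: 'a :: complex_hilbert_space \<Rightarrow> 'a)"
  using assms by unfold_locales

lemma clinear_add: "clinear (T :: 'a :: complex_hilbert_space \<Rightarrow> 'a) \<Longrightarrow> T (x + y) = T x + T y"
  by (simp add: Vector_Spaces.linear_iff)

lemma clinear_scale: "clinear (T :: 'a :: complex_hilbert_space \<Rightarrow> 'a) \<Longrightarrow> T (c *\<^sub>C x) = c *\<^sub>C T x"
  by (simp add: Vector_Spaces.linear_iff)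

lemma clinear_zero: "clinear (T :: 'a :: complex_hilbert_space \<Rightarrow> 'a) \<Longrightarrow> T 0 = 0"
  using clinear_scale[of T 0 0] by simp

lemma clinear_diff: "clinear (T :: 'a :: complex_hilbert_space \<Rightarrow> 'a) \<Longrightarrow> T (x - y) = T x - T y"
  using clinear_add[of T "x - y" y] by simp

lemma clinear_sum:
  "clinear (T :: 'a :: complex_hilbert_space \<Rightarrow> 'a) \<Longrightarrow> T (\<Sum>i\<in>I. f i) = (\<Sum>i\<in>I. T (f i))"
  by (induction I rule: infinite_finite_induct) (auto simp: clinear_add clinear_zero)


section \<open>Orthonormal sets\<close>

definition orthonormal :: "'a :: complex_hilbert_space set \<Rightarrow> bool"
  where "orthonormal E \<longleftrightarrow> (\<forall>e\<in>E. norm e = 1) \<and> (\<forall>e\<in>E. \<forall>f\<in>E. e \<noteq> f \<longrightarrow> cinner e f = 0)"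

lemma orthonormal_norm: "orthonormal E \<Longrightarrow> e \<in> E \<Longrightarrow> norm e = 1"
  by (simp add: orthonormal_def)

lemma orthonormal_cinner:
  "orthonormal E \<Longrightarrow> e \<in> E \<Longrightarrow> f \<in> E \<Longrightarrow> cinner e f = (if e = f then 1 else 0)"
  by (simp add: orthonormal_def cinner_self)

lemma orthogonal_to_span:
  assumes "v \<in> cspan E" "\<And>f. f \<in> E \<Longrightarrow> cinner f e = 0"
  shows "cinner v e = 0"
  using assms(1)
proof (induction rule: complex_vector.span_induct_alt)
  case (step c x y)
  then show ?case by (simp add: cinner_add_left cinner_scaleC_left assms(2))
qed simp

lemma orthonormal_independent:
  assumes "orthonormal E"
  shows "\<not> complex_vector.dependent E"
proof
  assume "complex_vector.dependent E"
  then obtain e where e: "e \<in> E" "e \<in> cspan (E - {e})"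
    unfolding complex_vector.dependent_def by blast
  then have "cinner e e = 0"
    by (intro orthogonal_to_span[of e "E - {e}"]) (use assms in \<open>auto simp: orthonormal_def\<close>)
  then show False
    using orthonormal_cinner[OF assms e(1) e(1)] by simp
qed

lemma residual_orthogonal:
  assumes "orthonormal E" "finite E" "f \<in> E"
  shows "cinner (v - (\<Sum>e\<in>E. cinner v e *\<^sub>C e)) f = 0"
proof -
  have "cinner (\<Sum>e\<in>E. cinner v e *\<^sub>C e) f = (\<Sum>e\<in>E. if e = f then cinner v e else 0)"
    unfolding cinner_sum_left
    by (intro sum.cong refl) (simp add: cinner_scaleC_left orthonormal_cinner[OF assms(1) _ assms(3)])
  then show ?thesis
    using assms by (simp add: cinner_diff_left)
qed

lemma bessel:
  assumes E: "orthonormal E" "finite E"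
  shows "(\<Sum>e\<in>E. (cmod (cinner v e))\<^sup>2) + (norm (v - (\<Sum>e\<in>E. cinner v e *\<^sub>C e)))\<^sup>2 = (norm v)\<^sup>2"
proof -
  define p where "p = (\<Sum>e\<in>E. cinner v e *\<^sub>C e)"
  have "cinner f (v - p) = 0" if "f \<in> E" for f
    using residual_orthogonal[OF E that] cinner_eq_zero_commute unfolding p_def by blast
  then have orth: "cinner p (v - p) = 0"
    by (simp add: p_def cinner_sum_left cinner_scaleC_left)
  have "cinner p v = (\<Sum>e\<in>E. complex_of_real ((cmod (cinner v e))\<^sup>2))"
    unfolding p_def cinner_sum_left
    by (intro sum.cong refl)
      (metis cinner_scaleC_left cinner_commute complex_norm_square)
  moreover have "cinner p p = cinner p v"
    using orth by (simp add: cinner_diff_right)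
  ultimately have "(norm p)\<^sup>2 = (\<Sum>e\<in>E. (cmod (cinner v e))\<^sup>2)"
    by (simp add: norm_sq_eq_Re_cinner)
  moreover have "(norm v)\<^sup>2 = (norm p)\<^sup>2 + (norm (v - p))\<^sup>2"
    using norm_sq_add[of p "v - p"] orth by simp
  ultimately show ?thesis
    by (simp add: p_def)
qed

lemma bessel_le:
  assumes "orthonormal E" "finite E"
  shows "(\<Sum>e\<in>E. (cmod (cinner v e))\<^sup>2) \<le> (norm v)\<^sup>2"
  using bessel[OF assms, of v] by (smt (verit) zero_le_power2)


section \<open>The Riesz representation theorem and adjoints of bounded operators\<close>

text \<open>The representing vector is the minimiser of \<open>J x = \<parallel>x\<parallel>\<^sup>2 - 2 Re (f x)\<close>. By the parallelogram
  identity \<open>J x + J y = 2 J ((x + y) / 2) + \<parallel>x - y\<parallel>\<^sup>2 / 2\<close>, so minimising sequences are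
  Cauchy, and vanishing of the first variation of \<open>J\<close> at the minimiser is the representation.\<close>

lemma riesz_representation:
  fixes f :: "'a :: complex_hilbert_space \<Rightarrow> complex"
  assumes f: "bounded_linear f" and homog: "\<And>c x. f (c *\<^sub>C x) = c * f x"
  obtains z where "\<And>x. f x = cinner x z"
proof -
  interpret f: bounded_linear f by fact
  define J where "J = (\<lambda>x. (norm x)\<^sup>2 - 2 * Re (f x))"
  obtain M where M: "\<And>x. cmod (f x) \<le> norm x * M"
    using f.bounded by blast
  have J_lower: "- M\<^sup>2 \<le> J x" for x
  proof -
    have "Re (f x) \<le> norm x * M"
      using M[of x] complex_Re_le_cmod[of "f x"] by linarith
    moreover have "0 \<le> (norm x - M)\<^sup>2" by simp
    ultimately show ?thesis
      unfolding J_def power2_diff by (simp add: algebra_simps)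
  qed
  define m where "m = (INF x. J x)"
  have m_le: "m \<le> J x" for x
    unfolding m_def by (rule cINF_lower) (use J_lower in \<open>auto intro!: bdd_belowI2[of _ "- M\<^sup>2"]\<close>)
  have "\<exists>x. J x < m + 1 / Suc n" for n
  proof -
    have "(INF x. J x) < m + 1 / Suc n" by (simp add: m_def)
    then show ?thesis
      using cInf_lessD[of "range J" "m + 1 / Suc n"] by auto
  qed
  then obtain u where u: "\<And>n. J (u n) < m + 1 / Suc n" by metis
  have par: "(norm (x - y))\<^sup>2 \<le> 2 * (J x - m) + 2 * (J y - m)" for x y
  proof -
    have "J ((1/2) *\<^sub>R (x + y)) = (norm (x + y))\<^sup>2 / 4 - Re (f x) - Re (f y)"
      by (simp add: J_def f.add f.scaleR power_divide add_divide_distrib)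
    then show ?thesis
      using m_le[of "(1/2) *\<^sub>R (x + y)"] norm_sq_diff[of x y] norm_sq_add[of x y]
      unfolding J_def by (simp add: algebra_simps)
  qed
  have "Cauchy u"
  proof (rule metric_CauchyI)
    fix e :: real assume "0 < e"
    then obtain N where N: "4 / (e\<^sup>2) < real N"
      using reals_Archimedean2 by blast
    have small: "J (u n) - m < e\<^sup>2 / 4" if "n \<ge> N" for n
    proof -
      have "4 / e\<^sup>2 < Suc n" using N that by (simp add: of_nat_Suc)
      then have "1 / Suc n < e\<^sup>2 / 4"
        using \<open>0 < e\<close> by (simp add: field_simps)
      then show ?thesis using u[of n] by linarith
    qed
    have "dist (u i) (u j) < e" if "i \<ge> N" "j \<ge> N" for i j
    proof -
      have "(norm (u i - u j))\<^sup>2 < e\<^sup>2"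
        using par[of "u i" "u j"] small[OF that(1)] small[OF that(2)] by argo
      then show ?thesis
        using \<open>0 < e\<close> by (simp add: dist_norm power2_less_imp_less)
    qed
    then show "\<exists>M. \<forall>m\<ge>M. \<forall>n\<ge>M. dist (u m) (u n) < e" by blast
  qed
  then obtain z where z: "u \<longlonglongrightarrow> z"
    using Cauchy_convergent_iff convergent_def by blast
  have "(\<lambda>n. J (u n)) \<longlonglongrightarrow> J z"
    unfolding J_def by (intro tendsto_intros z f.tendsto)
  moreover have "(\<lambda>n. m + 1 / Suc n) \<longlonglongrightarrow> m + 0"
    by (intro tendsto_intros LIMSEQ_Suc[OF lim_1_over_n])
  ultimately have "J z \<le> m"
    using LIMSEQ_le[of "\<lambda>n. J (u n)" "J z" "\<lambda>n. m + 1 / Suc n" "m + 0"] u less_imp_le by auto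
  then have min: "J z \<le> J x" for x using m_le[of x] by linarith
  have Re_eq: "Re (f w) = Re (cinner w z)" for w
  proof -
    have first_variation: "2 * t * (Re (f w) - Re (cinner w z)) \<le> t\<^sup>2 * (norm w)\<^sup>2" for t
      using min[of "z + t *\<^sub>R w"] Re_cinner_commute[of z w]
      unfolding J_def norm_sq_add
      by (simp add: f.add f.scaleR scaleR_eq_scaleC[of t w] cinner_scaleC_right norm_scaleC
          power_mult_distrib homog algebra_simps)
    define d where "d = Re (f w) - Re (cinner w z)"
    define t where "t = d / ((norm w)\<^sup>2 + 1)"
    have "2 * t * d \<le> t\<^sup>2 * (norm w)\<^sup>2"
      using first_variation[of t] by (simp add: d_def)
    also have "\<dots> \<le> t\<^sup>2 * ((norm w)\<^sup>2 + 1)"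
      by (simp add: mult_left_mono)
    also have "\<dots> = t * d"
    proof -
      have "0 < (norm w)\<^sup>2 + 1" by (smt (verit) zero_le_power2)
      then show ?thesis by (simp add: t_def power2_eq_square)
    qed
    finally have "t * d \<le> 0" by argo
    moreover have "t * d = d\<^sup>2 / ((norm w)\<^sup>2 + 1)" by (simp add: t_def power2_eq_square)
    ultimately have "d = 0"
      by (smt (verit) divide_pos_pos zero_le_power2 zero_less_power2)
    then show ?thesis by (simp add: d_def)
  qed
  have "f w = cinner w z" for w
  proof (rule complex_eqI[OF Re_eq])
    show "Im (f w) = Im (cinner w z)"
      using Re_eq[of "\<i> *\<^sub>C w"] by (simp add: homog cinner_scaleC_left)
  qed
  then show ?thesis by (rule that)
qed

lemma cinner_bounded_adjoint:
  fixes K :: "'a :: complex_hilbert_space \<Rightarrow> 'a"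
  assumes "bounded_linear K" "clinear K"
  shows "cinner (K x) y = cinner x (bounded_adjoint K y)"
proof -
  have "bounded_linear (\<lambda>x. cinner (K x) y)"
    using bounded_linear_compose[OF bounded_linear_cinner_left assms(1)] .
  then obtain z where z: "\<And>x. cinner (K x) y = cinner x z"
    using riesz_representation[of "\<lambda>x. cinner (K x) y"]
      clinear_scale[OF assms(2)] cinner_scaleC_left by metis
  have "(THE z. \<forall>x. cinner (K x) y = cinner x z) = z"
  proof (rule the_equality)
    fix w assume w: "\<forall>x. cinner (K x) y = cinner x w"
    then have "cinner x w = cinner x z" for x using z by metis
    then have "cinner w x = cinner z x" for x by (metis cinner_commute)
    then show "w = z" by (rule vector_eq_by_cinner)
  qed (simp add: z)
  then show ?thesis
    by (simp add: bounded_adjoint_def adjoint_op_def z)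
qed

lemma cinner_bounded_adjoint_left:
  fixes K :: "'a :: complex_hilbert_space \<Rightarrow> 'a"
  assumes "bounded_linear K" "clinear K"
  shows "cinner (bounded_adjoint K y) x = cinner y (K x)"
  by (metis assms cinner_bounded_adjoint cinner_commute)

lemma clinear_bounded_adjoint:
  fixes K :: "'a :: complex_hilbert_space \<Rightarrow> 'a"
  assumes "bounded_linear K" "clinear K"
  shows "clinear (bounded_adjoint K)"
  by (intro clinearI vector_eq_by_cinner)
    (simp_all add: cinner_bounded_adjoint_left[OF assms] cinner_add_left cinner_scaleC_left)

lemma bounded_linear_bounded_adjoint:
  fixes K :: "'a :: complex_hilbert_space \<Rightarrow> 'a"
  assumes "bounded_linear K" "clinear K"
  shows "bounded_linear (bounded_adjoint K)"
proof -
  obtain M where "0 < M" and M: "\<And>x. norm (K x) \<le> norm x * M"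
    using bounded_linear.pos_bounded[OF assms(1)] by blast
  show ?thesis
  proof (rule clinear_bounded_imp_bounded_linear[OF clinear_bounded_adjoint[OF assms], of M])
    fix y
    let ?z = "bounded_adjoint K y"
    have "(norm ?z)\<^sup>2 = cmod (cinner (K ?z) y)"
      by (simp add: cinner_bounded_adjoint[OF assms] cinner_self norm_power)
    also have "\<dots> \<le> norm (K ?z) * norm y" by (rule cauchy_schwarz)
    also have "\<dots> \<le> norm ?z * M * norm y"
      using M by (intro mult_right_mono) auto
    finally show "norm ?z \<le> norm y * M"
      using \<open>0 < M\<close> by (cases "norm ?z = 0") (auto simp: power2_eq_square mult_ac)
  qed
qed


section \<open>Singular values of compact operators\<close>

lemma compact_op_clinear: "compact_op K \<Longrightarrow> clinear K"
  by (simp add: compact_op_def)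

lemma compact_op_bounded_linear:
  assumes "compact_op K"
  shows "bounded_linear K"
proof -
  note lin = compact_op_clinear[OF assms]
  have "bounded (closure (K ` cball 0 1))"
    using assms by (intro compact_imp_bounded) (simp add: compact_op_def)
  then obtain B where B: "\<And>y. y \<in> closure (K ` cball 0 1) \<Longrightarrow> norm y \<le> B"
    unfolding bounded_iff by metis
  show ?thesis
  proof (rule clinear_bounded_imp_bounded_linear[OF lin])
    fix x
    show "norm (K x) \<le> norm x * B"
    proof (cases "x = 0")
      case False
      let ?u = "complex_of_real (1 / norm x) *\<^sub>C x"
      have "norm ?u = 1" using False by (simp add: norm_scaleC norm_divide)
      then have "K ?u \<in> closure (K ` cball 0 1)"
        using closure_subset by fastforce
      then have "norm (K ?u) \<le> B" by (rule B)
      then show ?thesis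
        using False by (simp add: clinear_scale[OF lin] norm_scaleC norm_divide field_simps)
    qed (simp add: clinear_zero[OF lin])
  qed
qed

context
  fixes K :: "'a :: complex_hilbert_space \<Rightarrow> 'a"
  assumes K: "compact_op K"
begin

private lemmas bl = compact_op_bounded_linear[OF K]
private lemmas cl = compact_op_clinear[OF K]

private lemma cinner_KK: "cinner (bounded_adjoint K (K x)) y = cinner (K x) (K y)"
  by (rule cinner_bounded_adjoint_left[OF bl cl])

private lemma cinner_KK_commute:
  "cinner (bounded_adjoint K (K x)) y = cinner x (bounded_adjoint K (K y))"
  by (simp add: cinner_bounded_adjoint_left[OF bl cl] cinner_bounded_adjoint[OF bl cl])

private lemma clinear_KK: "clinear (\<lambda>x. bounded_adjoint K (K x))"
  using cl clinear_bounded_adjoint[OF bl cl]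
  by (intro clinearI) (simp_all add: clinear_add clinear_scale)

private lemma convergent_image_subsequence:
  assumes "\<And>n. norm (u n) \<le> 1"
  obtains r y where "strict_mono (r :: nat \<Rightarrow> nat)" "(\<lambda>n. K (u (r n))) \<longlonglongrightarrow> y"
proof -
  have "seq_compact (closure (K ` cball 0 1))"
    using K compact_eq_seq_compact_metric unfolding compact_op_def by blast
  moreover have "K (u n) \<in> closure (K ` cball 0 1)" for n
    using assms[of n] closure_subset[of "K ` cball 0 1"] by auto
  then have "\<forall>n. K (u n) \<in> closure (K ` cball 0 1)" by blast
  ultimately obtain y r where "strict_mono (r :: nat \<Rightarrow> nat)" "((\<lambda>n. K (u n)) \<circ> r) \<longlonglongrightarrow> y"
    by (rule seq_compactE)
  then show ?thesis
    using that by (simp add: o_def)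
qed

text \<open>Since \<open>F\<close> consists of eigenvectors, \<open>K\<^sup>*K\<close> leaves \<open>F\<^sup>\<bottom>\<close> invariant. Let \<open>s\<close> be the norm of \<open>K\<close> on
  \<open>F\<^sup>\<bottom>\<close> and \<open>u\<^sub>n\<close> vectors in its unit ball with \<open>\<parallel>K u\<^sub>n\<parallel> \<rightarrow> s\<close>. Since
  \<open>\<parallel>K\<^sup>*K u - s\<^sup>2 u\<parallel>\<^sup>2 \<le> 2 s\<^sup>4 - 2 s\<^sup>2 \<parallel>K u\<parallel>\<^sup>2\<close>, the \<open>u\<^sub>n\<close> are approximate eigenvectors, and compactness
  of \<open>K\<close> makes a subsequence converge if \<open>s > 0\<close>. For \<open>s = 0\<close> the zero vector is taken.\<close>

lemma maximal_singular_vector: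
  assumes F: "\<And>f. f \<in> F \<Longrightarrow> \<exists>t. bounded_adjoint K (K f) = complex_of_real t *\<^sub>C f"
  shows "\<exists>e s. 0 \<le> s \<and> (\<forall>x. (\<forall>f\<in>F. cinner x f = 0) \<longrightarrow> norm (K x) \<le> s * norm x) \<and>
    bounded_adjoint K (K e) = complex_of_real (s\<^sup>2) *\<^sub>C e \<and> (\<forall>f\<in>F. cinner e f = 0) \<and>
    norm e = (if s = 0 then 0 else 1)"
proof -
  define T where "T = (\<lambda>x. bounded_adjoint K (K x))"
  have T_lin: "clinear T" unfolding T_def by (rule clinear_KK)
  define M where "M = {x. \<forall>f\<in>F. cinner x f = 0}"
  have zero: "0 \<in> M" by (simp add: M_def)
  define X where "X = (\<lambda>x. norm (K x)) ` (M \<inter> cball 0 1)"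
  define s where "s = Sup X"
  obtain B where "0 < B" and B: "\<And>x. norm (K x) \<le> norm x * B"
    using bounded_linear.pos_bounded[OF bl] by blast
  have "norm (K x) \<le> B" if "norm x \<le> 1" for x
    using B[of x] mult_right_mono[OF that, of B] \<open>0 < B\<close> by linarith
  then have bdd: "bdd_above X"
    unfolding X_def by (intro bdd_aboveI2[of _ _ B]) simp
  have "0 \<in> X" unfolding X_def
    by (rule image_eqI[of _ _ 0]) (use zero in \<open>auto simp: clinear_zero[OF cl]\<close>)
  then have s_nonneg: "0 \<le> s" unfolding s_def using bdd by (rule cSup_upper)
  have le1: "norm (K x) \<le> s" if "x \<in> M" "norm x \<le> 1" for x
    unfolding s_def by (rule cSup_upper[OF _ bdd]) (use that in \<open>auto simp: X_def\<close>)
  have le: "norm (K x) \<le> s * norm x" if "x \<in> M" for x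
  proof (cases "x = 0")
    case False
    let ?u = "complex_of_real (1 / norm x) *\<^sub>C x"
    have "?u \<in> M" using that by (simp add: M_def cinner_scaleC_left)
    moreover have "norm ?u \<le> 1" using False by (simp add: norm_scaleC norm_divide)
    ultimately have "norm (K ?u) \<le> s" by (rule le1)
    then show ?thesis
      using False by (simp add: clinear_scale[OF cl] norm_scaleC norm_divide field_simps)
  qed (simp add: clinear_zero[OF cl])
  show ?thesis
  proof (cases "s = 0")
    case True
    then show ?thesis
      using True le clinear_zero[OF T_lin] unfolding T_def M_def
      by (intro exI[of _ 0]) auto
  next
    case False
    then have "0 < s" using s_nonneg by simp
    have "\<exists>x. x \<in> M \<and> norm x \<le> 1 \<and> s - 1 / Suc n < norm (K x)" for n
    proof -
      have "s - 1 / Suc n < Sup X" by (simp add: s_def)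
      then obtain y where "y \<in> X" "s - 1 / Suc n < y"
        using \<open>0 \<in> X\<close> less_cSupD[of X] by blast
      then show ?thesis by (auto simp: X_def)
    qed
    then obtain u where uM: "\<And>n. u n \<in> M" and u1: "\<And>n. norm (u n) \<le> 1"
      and us: "\<And>n. s - 1 / Suc n < norm (K (u n))" by metis
    have "(\<lambda>n. s - 1 / Suc n) \<longlonglongrightarrow> s - 0"
      by (intro tendsto_intros LIMSEQ_Suc[OF lim_1_over_n])
    then have lower: "(\<lambda>n. s - 1 / Suc n) \<longlonglongrightarrow> s" by simp
    have Ku_lim: "(\<lambda>n. norm (K (u n))) \<longlonglongrightarrow> s"
      by (rule tendsto_sandwich[OF _ _ lower tendsto_const])
        (use us le1[OF uM u1] in \<open>simp_all add: less_imp_le\<close>)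
    have T_le: "norm (T x) \<le> s\<^sup>2 * norm x" if x: "x \<in> M" for x
    proof -
      have TM: "T x \<in> M"
        unfolding M_def
      proof safe
        fix f assume f: "f \<in> F"
        obtain t where t: "T f = complex_of_real t *\<^sub>C f" using F[OF f] unfolding T_def by blast
        have "cinner (T x) f = cinner x (T f)" unfolding T_def by (rule cinner_KK_commute)
        then show "cinner (T x) f = 0"
          using x f by (simp add: t cinner_scaleC_right M_def)
      qed
      have "(norm (T x))\<^sup>2 = Re (cinner (K x) (K (T x)))"
        using cinner_KK[of x "T x"] by (simp add: T_def norm_sq_eq_Re_cinner)
      also have "\<dots> \<le> cmod (cinner (K x) (K (T x)))" by (rule complex_Re_le_cmod)
      also have "\<dots> \<le> norm (K x) * norm (K (T x))" by (rule cauchy_schwarz)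
      also have "\<dots> \<le> (s * norm x) * (s * norm (T x))"
        using le[OF x] le[OF TM] by (intro mult_mono) (auto simp: s_nonneg)
      finally show ?thesis
        using s_nonneg by (cases "norm (T x) = 0") (auto simp: power2_eq_square mult_ac)
    qed
    define d where "d = (\<lambda>n. T (u n) - complex_of_real (s\<^sup>2) *\<^sub>C u n)"
    have d_le: "(norm (d n))\<^sup>2 \<le> 2 * s^4 - 2 * s\<^sup>2 * (norm (K (u n)))\<^sup>2" for n
    proof -
      have "Re (cinner (T (u n)) (u n)) = (norm (K (u n)))\<^sup>2"
        by (simp add: T_def cinner_KK norm_sq_eq_Re_cinner)
      then have "(norm (d n))\<^sup>2 = (norm (T (u n)))\<^sup>2 - 2 * s\<^sup>2 * (norm (K (u n)))\<^sup>2 + (s\<^sup>2 * norm (u n))\<^sup>2"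
        by (simp add: d_def norm_sq_diff cinner_scaleC_right norm_scaleC norm_power del: of_real_power)
      moreover have "norm (T (u n)) \<le> s\<^sup>2" "s\<^sup>2 * norm (u n) \<le> s\<^sup>2"
        using T_le[OF uM[of n]] u1[of n] mult_left_mono[OF u1[of n], of "s\<^sup>2"] by auto
      then have "(norm (T (u n)))\<^sup>2 \<le> (s\<^sup>2)\<^sup>2" "(s\<^sup>2 * norm (u n))\<^sup>2 \<le> (s\<^sup>2)\<^sup>2"
        using s_nonneg by (simp_all only: power_mono norm_ge_zero mult_nonneg_nonneg zero_le_power2)
      ultimately show ?thesis by simp
    qed
    have "(\<lambda>n. 2 * s^4 - 2 * s\<^sup>2 * (norm (K (u n)))\<^sup>2) \<longlonglongrightarrow> 2 * s^4 - 2 * s\<^sup>2 * s\<^sup>2"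
      by (intro tendsto_intros Ku_lim)
    then have "(\<lambda>n. 2 * s^4 - 2 * s\<^sup>2 * (norm (K (u n)))\<^sup>2) \<longlonglongrightarrow> 0"
      by (simp add: power2_eq_square power4_eq_xxxx)
    then have "(\<lambda>n. (norm (d n))\<^sup>2) \<longlonglongrightarrow> 0"
      by (rule tendsto_sandwich[of "\<lambda>n. 0", rotated 3]) (auto simp: d_le intro!: always_eventually)
    then have "(\<lambda>n. sqrt ((norm (d n))\<^sup>2)) \<longlonglongrightarrow> sqrt 0"
      by (rule tendsto_real_sqrt)
    then have d0: "d \<longlonglongrightarrow> 0"
      by (simp add: tendsto_norm_zero_iff)
    obtain r y where r: "strict_mono r" and y: "(\<lambda>n. K (u (r n))) \<longlonglongrightarrow> y"
      by (rule convergent_image_subsequence[OF u1])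
    have "(\<lambda>n. T (u (r n))) \<longlonglongrightarrow> bounded_adjoint K y"
      using bounded_linear.tendsto[OF bounded_linear_bounded_adjoint[OF bl cl] y]
      by (simp add: T_def)
    moreover have "(\<lambda>n. d (r n)) \<longlonglongrightarrow> 0"
      using LIMSEQ_subseq_LIMSEQ[OF d0 r] by (simp add: o_def)
    ultimately have "(\<lambda>n. T (u (r n)) - d (r n)) \<longlonglongrightarrow> bounded_adjoint K y - 0"
      by (rule tendsto_diff)
    then have "(\<lambda>n. complex_of_real (s\<^sup>2) *\<^sub>C u (r n)) \<longlonglongrightarrow> bounded_adjoint K y"
      by (simp add: d_def)
    then have "(\<lambda>n. complex_of_real (1 / s\<^sup>2) *\<^sub>C complex_of_real (s\<^sup>2) *\<^sub>C u (r n)) \<longlonglongrightarrow>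
        complex_of_real (1 / s\<^sup>2) *\<^sub>C bounded_adjoint K y"
      by (rule bounded_linear.tendsto[OF bounded_linear_scaleC])
    moreover define e where "e = complex_of_real (1 / s\<^sup>2) *\<^sub>C bounded_adjoint K y"
    moreover have inv: "complex_of_real (1 / s\<^sup>2) * complex_of_real (s\<^sup>2) = 1"
      using False by (subst of_real_mult[symmetric]) simp
    ultimately have ue: "(\<lambda>n. u (r n)) \<longlonglongrightarrow> e"
      by (simp only: scaleC_scaleC scaleC_one)
    have "cinner e f = 0" if "f \<in> F" for f
    proof -
      have "(\<lambda>n. cinner (u (r n)) f) \<longlonglongrightarrow> cinner e f"
        by (rule bounded_linear.tendsto[OF bounded_linear_cinner_left ue])
      moreover have "cinner (u (r n)) f = 0" for n
        using uM that by (simp add: M_def)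
      ultimately show ?thesis by (simp add: LIMSEQ_const_iff)
    qed
    then have eM: "e \<in> M" by (simp add: M_def)
    have Ke: "(\<lambda>n. K (u (r n))) \<longlonglongrightarrow> K e"
      by (rule bounded_linear.tendsto[OF bl ue])
    then have "K e = y"
      using y LIMSEQ_unique by blast
    then have eig: "bounded_adjoint K (K e) = complex_of_real (s\<^sup>2) *\<^sub>C e"
      using inv by (simp only: e_def scaleC_scaleC mult.commute[of "complex_of_real (s\<^sup>2)"] scaleC_one)
    have "(\<lambda>n. norm (K (u (r n)))) \<longlonglongrightarrow> s"
      using LIMSEQ_subseq_LIMSEQ[OF Ku_lim r] by (simp add: o_def)
    then have "norm (K e) = s"
      using tendsto_norm[OF Ke] LIMSEQ_unique by blast
    then have "1 \<le> norm e" using le[OF eM] \<open>0 < s\<close> by simp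
    moreover have "norm e \<le> 1"
      by (rule LIMSEQ_le_const2[OF tendsto_norm[OF ue]]) (use u1 in auto)
    ultimately show ?thesis
      using s_nonneg le eM eig False unfolding M_def
      by (intro exI[of _ e] exI[of _ s]) auto
  qed
qed

lemma singular_system_exists:
  obtains \<phi> :: "nat \<Rightarrow> 'a" and s :: "nat \<Rightarrow> real"
  where "\<And>n. 0 \<le> s n"
    and "\<And>n x. \<forall>m<n. cinner x (\<phi> m) = 0 \<Longrightarrow> norm (K x) \<le> s n * norm x"
    and "\<And>n. bounded_adjoint K (K (\<phi> n)) = complex_of_real ((s n)\<^sup>2) *\<^sub>C \<phi> n"
    and "\<And>m n. m \<noteq> n \<Longrightarrow> cinner (\<phi> n) (\<phi> m) = 0"
    and "\<And>n. norm (\<phi> n) = (if s n = 0 then 0 else 1)"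
proof -
  define P :: "(nat \<Rightarrow> 'a \<times> real) \<Rightarrow> nat \<Rightarrow> 'a \<times> real \<Rightarrow> bool" where "P = (\<lambda>f n (e, s). 0 \<le> s \<and>
    (\<forall>x. (\<forall>g\<in>(\<lambda>m. fst (f m)) ` {..<n}. cinner x g = 0) \<longrightarrow> norm (K x) \<le> s * norm x) \<and>
    bounded_adjoint K (K e) = complex_of_real (s\<^sup>2) *\<^sub>C e \<and>
    (\<forall>g\<in>(\<lambda>m. fst (f m)) ` {..<n}. cinner e g = 0) \<and>
    norm e = (if s = 0 then 0 else 1))"
  have "\<exists>f. \<forall>n. P f n (f n)"
  proof (rule dependent_wellorder_choice)
    fix f g :: "nat \<Rightarrow> 'a \<times> real" and r n assume "\<And>m. m < n \<Longrightarrow> f m = g m"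
    then show "P f n r = P g n r" by (auto simp: P_def split: prod.splits)
  next
    fix n and f :: "nat \<Rightarrow> 'a \<times> real" assume f: "\<And>m. m < n \<Longrightarrow> P f m (f m)"
    have "\<exists>t. bounded_adjoint K (K e) = complex_of_real t *\<^sub>C e"
      if e: "e \<in> (\<lambda>m. fst (f m)) ` {..<n}" for e
    proof -
      obtain m where m: "m < n" "e = fst (f m)" using e by blast
      then show ?thesis
        using f[OF m(1)] by (intro exI[of _ "(snd (f m))\<^sup>2"]) (auto simp: P_def split: prod.splits)
    qed
    then have "\<exists>e s. P f n (e, s)"
      unfolding P_def prod.case by (rule maximal_singular_vector)
    then show "\<exists>r. P f n r" by blast
  qed
  then obtain f where f: "\<And>n. P f n (f n)" by blast
  define \<phi> where "\<phi> n = fst (f n)" for n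
  define s where "s n = snd (f n)" for n
  have facts: "0 \<le> s n"
      "\<And>x. (\<forall>m<n. cinner x (\<phi> m) = 0) \<longrightarrow> norm (K x) \<le> s n * norm x"
      "bounded_adjoint K (K (\<phi> n)) = complex_of_real ((s n)\<^sup>2) *\<^sub>C \<phi> n"
      "\<forall>m<n. cinner (\<phi> n) (\<phi> m) = 0" "norm (\<phi> n) = (if s n = 0 then 0 else 1)" for n
    using f[of n] unfolding P_def \<phi>_def s_def by (auto split: prod.splits)
  have "cinner (\<phi> n) (\<phi> m) = 0" if "m \<noteq> n" for m n
    using that facts(4)[of n] facts(4)[of m] cinner_eq_zero_commute by (metis nat_neq_iff)
  then show ?thesis
    using that[of s \<phi>] facts by blast
qed

text \<open>At the first difference the larger value would occur too often in one of the sequences. This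
  makes the multiplicities of the positive eigenvalues of \<open>K\<^sup>*K\<close> determine the singular values.\<close>

lemma decseq_eq_if_multiplicities_eq:
  fixes s s' :: "nat \<Rightarrow> real"
  assumes "decseq s" "decseq s'" "\<And>n. 0 \<le> s n" "\<And>n. 0 \<le> s' n"
    and fin: "\<And>t. 0 < t \<Longrightarrow> finite {n. s n = t}" "\<And>t. 0 < t \<Longrightarrow> finite {n. s' n = t}"
    and card: "\<And>t. 0 < t \<Longrightarrow> card {n. s n = t} = card {n. s' n = t}"
  shows "s = s'"
proof -
  have le: "a n \<le> b n"
    if "decseq b" "\<And>n. 0 \<le> b n" "\<And>m. m < n \<Longrightarrow> a m = b m"
      "\<And>t. 0 < t \<Longrightarrow> finite {n. a n = t}"
      "\<And>t. 0 < t \<Longrightarrow> card {n. a n = t} = card {n. b n = t}" for a b :: "nat \<Rightarrow> real" and n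
  proof (rule ccontr)
    assume "\<not> a n \<le> b n"
    then have lt: "b n < a n" by simp
    then have pos: "0 < a n" using that(2)[of n] by linarith
    have "{k. b k = a n} \<subset> {k. a k = a n}"
    proof
      show "{k. b k = a n} \<subseteq> {k. a k = a n}"
      proof safe
        fix k assume k: "b k = a n"
        then have "k < n" using decseqD[OF that(1), of n k] lt by (metis linorder_not_le)
        then show "a k = a n" using k that(3) by simp
      qed
      show "{k. b k = a n} \<noteq> {k. a k = a n}" using lt by force
    qed
    then show False
      using psubset_card_mono[OF that(4)[OF pos], of "{k. b k = a n}"] that(5)[OF pos] by linarith
  qed
  have "s n = s' n" for n
  proof (induction n rule: less_induct)
    case (less n)
    show ?case
      using le[of s' n s] le[of s n s'] assms less by (metis order_antisym)
  qed
  then show ?thesis by blast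
qed

text \<open>The greedy construction misses no positive eigenvalue of \<open>K\<^sup>*K\<close>: an eigenvector of \<open>K\<^sup>*K\<close> for
  \<open>t\<^sup>2 > 0\<close> that is orthogonal to all \<open>\<phi> n\<close> with \<open>s n = t\<close> is orthogonal to every \<open>\<phi> n\<close>, hence in the
  kernel of \<open>K\<close>. So the \<open>\<phi> n\<close> with \<open>s n = t\<close> are a basis of that eigenspace.\<close>

theorem singular_system:
  obtains \<phi> :: "nat \<Rightarrow> 'a"
  where "\<And>n. 0 \<le> singular_value K n"
    and "singular_value K \<longlonglongrightarrow> 0"
    and "\<And>n x. \<forall>m<n. cinner x (\<phi> m) = 0 \<Longrightarrow> norm (K x) \<le> singular_value K n * norm x"
    and "\<And>n. bounded_adjoint K (K (\<phi> n)) = complex_of_real ((singular_value K n)\<^sup>2) *\<^sub>C \<phi> n"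
    and "\<And>m n. m \<noteq> n \<Longrightarrow> cinner (\<phi> n) (\<phi> m) = 0"
    and "\<And>n. norm (\<phi> n) = (if singular_value K n = 0 then 0 else 1)"
proof -
  obtain \<phi> :: "nat \<Rightarrow> 'a" and s :: "nat \<Rightarrow> real" where nn: "\<And>n. 0 \<le> s n"
    and max: "\<And>n x. \<forall>m<n. cinner x (\<phi> m) = 0 \<Longrightarrow> norm (K x) \<le> s n * norm x"
    and eig: "\<And>n. bounded_adjoint K (K (\<phi> n)) = complex_of_real ((s n)\<^sup>2) *\<^sub>C \<phi> n"
    and orth: "\<And>m n. m \<noteq> n \<Longrightarrow> cinner (\<phi> n) (\<phi> m) = 0"
    and nrm: "\<And>n. norm (\<phi> n) = (if s n = 0 then 0 else 1)"
    by (rule singular_system_exists) (rule that)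
  have KK: "cinner (K (\<phi> n)) (K (\<phi> m)) = complex_of_real ((s n)\<^sup>2) * cinner (\<phi> n) (\<phi> m)" for m n
    using cinner_KK[of "\<phi> n" "\<phi> m"] by (simp add: eig cinner_scaleC_left)
  have norm_K: "norm (K (\<phi> n)) = s n" for n
  proof -
    have "(norm (K (\<phi> n)))\<^sup>2 = (s n)\<^sup>2"
      using KK[of n n] nrm[of n] unfolding norm_sq_eq_Re_cinner[of "K (\<phi> n)"]
      by (cases "s n = 0") (simp_all add: cinner_self)
    then show ?thesis using nn[of n] by (simp add: power2_eq_iff_nonneg)
  qed
  have dec: "decseq s"
  proof (rule decseq_SucI)
    fix n
    have "norm (K (\<phi> (Suc n))) \<le> s n * norm (\<phi> (Suc n))"
      by (rule max) (simp add: orth)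
    then show "s (Suc n) \<le> s n"
      using nn[of n] nrm[of "Suc n"] by (auto simp: norm_K split: if_splits)
  qed
  have lim: "s \<longlonglongrightarrow> 0"
  proof (rule ccontr)
    assume "\<not> s \<longlonglongrightarrow> 0"
    then obtain \<epsilon> where "0 < \<epsilon>" and frequent: "\<And>N. \<exists>n\<ge>N. \<epsilon> \<le> s n"
      using nn unfolding LIMSEQ_iff by (metis abs_of_nonneg diff_zero not_less real_norm_def)
    then have ge: "\<epsilon> \<le> s n" for n
      using decseqD[OF dec] by (metis order_trans)
    have unit: "norm (\<phi> n) = 1" for n using ge[of n] nrm[of n] \<open>0 < \<epsilon>\<close> by auto
    obtain r y where r: "strict_mono r" and y: "(\<lambda>n. K (\<phi> (r n))) \<longlonglongrightarrow> y"
      by (rule convergent_image_subsequence[OF eq_refl[OF unit]])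
    then have "Cauchy (\<lambda>n. K (\<phi> (r n)))" by (meson LIMSEQ_imp_Cauchy)
    then obtain N where N: "\<And>m n. m \<ge> N \<Longrightarrow> n \<ge> N \<Longrightarrow> dist (K (\<phi> (r m))) (K (\<phi> (r n))) < \<epsilon>"
      using \<open>0 < \<epsilon>\<close> unfolding Cauchy_def by fastforce
    let ?i = "r N" and ?j = "r (Suc N)"
    have "?i \<noteq> ?j" using r by (simp add: strict_mono_eq)
    then have "cinner (K (\<phi> ?i)) (K (\<phi> ?j)) = 0" by (simp add: KK orth)
    then have "(norm (K (\<phi> ?i) - K (\<phi> ?j)))\<^sup>2 = (s ?i)\<^sup>2 + (s ?j)\<^sup>2"
      by (simp add: norm_sq_diff norm_K)
    moreover have "(norm (K (\<phi> ?i) - K (\<phi> ?j)))\<^sup>2 < \<epsilon>\<^sup>2"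
      using N[of N "Suc N"] \<open>0 < \<epsilon>\<close> by (simp add: dist_norm power_strict_mono)
    moreover have "\<epsilon>\<^sup>2 \<le> (s ?i)\<^sup>2"
      using ge[of ?i] \<open>0 < \<epsilon>\<close> by (simp add: power_mono)
    ultimately show False by (smt (verit) zero_le_power2)
  qed
  have fin: "finite {n. s n = t}" if t: "0 < t" for t
  proof -
    obtain N where "\<And>n. n \<ge> N \<Longrightarrow> s n < t"
      using order_tendstoD(2)[OF lim t] unfolding eventually_sequentially by blast
    then have "{n. s n = t} \<subseteq> {..<N}" by (force simp: not_le[symmetric])
    then show ?thesis using finite_subset by blast
  qed
  have card: "card {n. s n = t} = cdim {x. bounded_adjoint K (K x) = complex_of_real (t\<^sup>2) *\<^sub>C x}"
    if "0 < t" for t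
  proof -
    define I where "I = {n. s n = t}"
    define W where "W = {x. bounded_adjoint K (K x) = complex_of_real (t\<^sup>2) *\<^sub>C x}"
    have unit: "norm (\<phi> n) = 1" if "n \<in> I" for n
      using that \<open>0 < t\<close> nrm[of n] by (simp add: I_def)
    have inj: "inj_on \<phi> I"
    proof (rule inj_onI, rule ccontr)
      fix m n assume mn: "m \<in> I" "n \<in> I" "\<phi> m = \<phi> n" "m \<noteq> n"
      then have "cinner (\<phi> n) (\<phi> n) = 0" using orth[of m n] by simp
      then show False using unit[OF mn(2)] by (simp add: cinner_self)
    qed
    have on: "orthonormal (\<phi> ` I)"
      unfolding orthonormal_def by (auto simp: unit intro!: orth)
    have "W \<subseteq> cspan (\<phi> ` I)"
    proof
      fix x assume x: "x \<in> W"
      define y where "y = x - (\<Sum>e\<in>\<phi> ` I. cinner x e *\<^sub>C e)"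
      have finI: "finite (\<phi> ` I)" using fin[OF \<open>0 < t\<close>] by (simp add: I_def)
      have W_lin: "bounded_adjoint K (K y) = complex_of_real (t\<^sup>2) *\<^sub>C y"
      proof -
        have "bounded_adjoint K (K (\<Sum>e\<in>\<phi> ` I. cinner x e *\<^sub>C e)) =
            (\<Sum>e\<in>\<phi> ` I. complex_of_real (t\<^sup>2) *\<^sub>C cinner x e *\<^sub>C e)"
          unfolding clinear_sum[OF clinear_KK]
        proof (intro sum.cong refl)
          fix e assume "e \<in> \<phi> ` I"
          then have "bounded_adjoint K (K e) = complex_of_real (t\<^sup>2) *\<^sub>C e"
            using eig by (auto simp: I_def)
          then show "bounded_adjoint K (K (cinner x e *\<^sub>C e)) = complex_of_real (t\<^sup>2) *\<^sub>C cinner x e *\<^sub>C e"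
            using clinear_scale[OF clinear_KK] by (simp add: scaleC_scaleC mult.commute)
        qed
        then show ?thesis
          using x unfolding y_def W_def
          by (simp add: clinear_diff[OF clinear_KK] complex_vector.scale_right_diff_distrib
              complex_vector.scale_sum_right)
      qed
      have orth_y: "cinner y (\<phi> n) = 0" for n
      proof (cases "n \<in> I")
        case True
        then show ?thesis
          unfolding y_def by (intro residual_orthogonal on finI) auto
      next
        case False
        have "complex_of_real (t\<^sup>2) * cinner y (\<phi> n) = complex_of_real ((s n)\<^sup>2) * cinner y (\<phi> n)"
          using cinner_KK_commute[of y "\<phi> n"]
          by (simp add: W_lin eig cinner_scaleC_left cinner_scaleC_right)
        moreover have "t\<^sup>2 \<noteq> (s n)\<^sup>2"
          using False \<open>0 < t\<close> nn[of n] by (auto simp: I_def power2_eq_iff_nonneg)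
        ultimately show ?thesis
          by (metis mult_right_cancel of_real_eq_iff)
      qed
      have "norm (K y) \<le> s n * norm y" for n
        by (rule max) (simp add: orth_y)
      then have "norm (K y) \<le> 0 * norm y"
        by (intro LIMSEQ_le_const[OF tendsto_mult[OF lim tendsto_const]]) auto
      then have "K y = 0" by simp
      then have "complex_of_real (t\<^sup>2) *\<^sub>C y = 0"
        using W_lin clinear_zero[OF clinear_bounded_adjoint[OF bl cl]] by simp
      then have "y = 0" using \<open>0 < t\<close> by simp
      then have "x = (\<Sum>e\<in>\<phi> ` I. cinner x e *\<^sub>C e)" by (simp add: y_def)
      also have "\<dots> \<in> cspan (\<phi> ` I)"
        by (intro complex_vector.span_sum complex_vector.span_scale complex_vector.span_base)
      finally show "x \<in> cspan (\<phi> ` I)" .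
    qed
    moreover have "\<phi> ` I \<subseteq> W" using eig by (auto simp: W_def I_def)
    ultimately have "cdim W = card (\<phi> ` I)"
      using complex_vector.dim_unique[OF _ _ orthonormal_independent[OF on] refl] by blast
    then show ?thesis
      using card_image[OF inj] by (simp add: W_def I_def)
  qed
  have "singular_value K = s"
    unfolding singular_value_def
  proof (rule the_equality)
    fix s' :: "nat \<Rightarrow> real"
    assume "decseq s' \<and> (\<forall>n. 0 \<le> s' n) \<and> (\<forall>t>0. finite {n. s' n = t} \<and>
      card {n. s' n = t} = cdim {x. bounded_adjoint K (K x) = complex_of_real (t\<^sup>2) *\<^sub>C x})"
    then show "s' = s"
      using dec nn fin card by (intro decseq_eq_if_multiplicities_eq) auto
  qed (use dec nn fin card in auto)
  then show ?thesis
    using that[of \<phi>] nn lim max eig orth nrm by blast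
qed

end


section \<open>Diagonal entries and Schatten norms\<close>

lemma orthonormal_family_image:
  assumes "\<And>i j. i \<in> I \<Longrightarrow> j \<in> I \<Longrightarrow> cinner (v i) (v j) = (if i = j then 1 else 0)"
  shows "orthonormal (v ` I)" "inj_on v I"
proof -
  have "norm (v i) = 1" if "i \<in> I" for i
  proof -
    have "(norm (v i))\<^sup>2 = 1"
      using assms[OF that that] by (simp add: norm_sq_eq_Re_cinner)
    then have "norm (v i) = 1 \<or> norm (v i) = - 1" by (simp add: power2_eq_1_iff)
    then show ?thesis using norm_ge_zero[of "v i"] by linarith
  qed
  then show "orthonormal (v ` I)"
    unfolding orthonormal_def using assms by auto
  show "inj_on v I"
  proof (rule inj_onI)
    fix i j assume "i \<in> I" "j \<in> I" "v i = v j"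
    then show "i = j" using assms[of i i] assms[of i j] by (auto split: if_splits)
  qed
qed

text \<open>Jensen's inequality for weights of total at most one, from the tangent of \<open>x powr p\<close> at
  \<open>y = \<Sum> a\<^sub>i s\<^sub>i\<close>. The missing weight sits at \<open>0\<close>, where the tangent is nonpositive because
  \<open>p \<ge> 1\<close>.\<close>

lemma powr_sum_le_subconvex:
  fixes a s :: "'i \<Rightarrow> real" and p :: real
  assumes p: "p \<ge> 1" and a: "\<And>i. i \<in> I \<Longrightarrow> 0 \<le> a i" "(\<Sum>i\<in>I. a i) \<le> 1"
    and s: "\<And>i. i \<in> I \<Longrightarrow> 0 \<le> s i"
  shows "(\<Sum>i\<in>I. a i * s i) powr p \<le> (\<Sum>i\<in>I. a i * s i powr p)"
proof -
  define y where "y = (\<Sum>i\<in>I. a i * s i)"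
  have "0 \<le> y" unfolding y_def using a s by (intro sum_nonneg mult_nonneg_nonneg)
  show ?thesis
  proof (cases "y = 0")
    case True
    then show ?thesis using a s by (auto simp: y_def intro!: sum_nonneg)
  next
    case False
    then have y: "0 < y" using \<open>0 \<le> y\<close> by simp
    have yp: "y powr p = y powr (p - 1) * y"
      using y powr_mult_base[of y "p - 1"] by (simp add: mult.commute)
    have tangent: "y powr p + p * y powr (p - 1) * (x - y) \<le> x powr p" if "0 \<le> x" for x
    proof (cases "x = 0")
      case True
      have "p * (y powr (p - 1) * y) \<ge> 1 * (y powr (p - 1) * y)"
        using p y by (intro mult_right_mono) auto
      then show ?thesis
        using True p by (simp add: yp)
    next
      case False
      have "((\<lambda>x. x powr p) has_real_derivative p * y powr (p - 1)) (at y within {0<..})"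
        using y by (auto intro!: derivative_eq_intros)
      then have "x powr p - y powr p \<ge> p * y powr (p - 1) * (x - y)"
        using False that y
        by (intro convex_on_imp_above_tangent[OF powr_convex[OF p], of y x])
          (auto simp: interior_open)
      then show ?thesis by simp
    qed
    define W where "W = (\<Sum>i\<in>I. a i)"
    have "y powr p \<le> y powr p * (W + p * (1 - W))"
    proof -
      have "1 * (1 - W) \<le> p * (1 - W)" using p a(2) by (intro mult_right_mono) (auto simp: W_def)
      then have "1 \<le> W + p * (1 - W)" by simp
      then have "y powr p * 1 \<le> y powr p * (W + p * (1 - W))" by (intro mult_left_mono) auto
      then show ?thesis by simp
    qed
    also have "\<dots> = W * y powr p + p * y powr (p - 1) * (y - W * y)"
      by (simp add: yp algebra_simps)
    also have "\<dots> = (\<Sum>i\<in>I. a i * (y powr p + p * y powr (p - 1) * (s i - y)))"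
    proof -
      have "(\<Sum>i\<in>I. a i * (y powr p + p * y powr (p - 1) * (s i - y))) =
          (\<Sum>i\<in>I. a i * y powr p + p * y powr (p - 1) * (a i * s i - a i * y))"
        by (intro sum.cong refl) (simp add: algebra_simps)
      then show ?thesis
        by (simp add: sum.distrib sum_subtractf W_def y_def flip: sum_distrib_left sum_distrib_right)
    qed
    also have "\<dots> \<le> (\<Sum>i\<in>I. a i * s i powr p)"
      by (intro sum_mono mult_left_mono tangent a(1) s)
    finally show ?thesis by (simp add: y_def)
  qed
qed

text \<open>With the Schmidt expansion \<open>K = \<Sum> s\<^sub>n \<langle>\<cdot>, \<phi>\<^sub>n\<rangle> \<psi>\<^sub>n\<close>, cut off after \<open>N\<close> terms at the price of an error
  \<open>s\<^sub>N\<close>, each \<open>\<bar>\<langle>K e, e\<rangle>\<bar>\<close> is at most \<open>\<Sum> a\<^sub>e\<^sub>n s\<^sub>n + s\<^sub>N\<close> for a doubly substochastic matrix \<open>a\<close>: its row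
  and column sums are bounded by Bessel's inequality. Jensen's inequality and \<open>N \<rightarrow> \<infinity>\<close> finish the
  proof.\<close>

theorem sum_diagonal_powr_le_schatten:
  fixes K :: "'a :: complex_hilbert_space \<Rightarrow> 'a"
  assumes K: "compact_op K" and E: "orthonormal E" "finite E" and p: "p \<ge> 1"
    and summ: "summable (\<lambda>n. singular_value K n powr p)"
  shows "(\<Sum>e\<in>E. cmod (cinner (K e) e) powr p) \<le> (\<Sum>n. singular_value K n powr p)"
proof -
  define s where "s = singular_value K"
  obtain \<phi> :: "nat \<Rightarrow> 'a" where nn: "\<And>n. 0 \<le> s n" and lim: "s \<longlonglongrightarrow> 0"
    and max: "\<And>n x. \<forall>m<n. cinner x (\<phi> m) = 0 \<Longrightarrow> norm (K x) \<le> s n * norm x"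
    and eig: "\<And>n. bounded_adjoint K (K (\<phi> n)) = complex_of_real ((s n)\<^sup>2) *\<^sub>C \<phi> n"
    and orth: "\<And>m n. m \<noteq> n \<Longrightarrow> cinner (\<phi> n) (\<phi> m) = 0"
    and nrm: "\<And>n. norm (\<phi> n) = (if s n = 0 then 0 else 1)"
    by (rule singular_system[OF K, folded s_def]) (rule that)
  note bl = compact_op_bounded_linear[OF K] and cl = compact_op_clinear[OF K]
  define \<psi> where "\<psi> n = complex_of_real (1 / s n) *\<^sub>C K (\<phi> n)" for n
  define S where "S = (\<Sum>n. s n powr p)"
  define c where "c e = cmod (cinner (K e) e)" for e
  have bound: "(\<Sum>e\<in>E. (max 0 (c e - s N)) powr p) \<le> S" for N
  proof -
    define I where "I = {n. n < N \<and> s n \<noteq> 0}"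
    have I: "finite I" by (simp add: I_def)
    have \<phi>_on: "cinner (\<phi> i) (\<phi> j) = (if i = j then 1 else 0)" if "i \<in> I" "j \<in> I" for i j
      using that orth[of j i] nrm[of i] by (auto simp: I_def cinner_self)
    have \<psi>_on: "cinner (\<psi> i) (\<psi> j) = (if i = j then 1 else 0)" if "i \<in> I" "j \<in> I" for i j
    proof -
      have "cinner (K (\<phi> i)) (K (\<phi> j)) = complex_of_real ((s i)\<^sup>2) * cinner (\<phi> i) (\<phi> j)"
        using cinner_bounded_adjoint_left[OF bl cl, of "K (\<phi> i)" "\<phi> j"]
        by (simp add: eig cinner_scaleC_left)
      then show ?thesis
        using that \<phi>_on[OF that]
        by (auto simp: \<psi>_def cinner_scaleC_left cinner_scaleC_right I_def power2_eq_square)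
    qed
    note \<phi>_image = orthonormal_family_image[of I \<phi>, OF \<phi>_on]
    note \<psi>_image = orthonormal_family_image[of I \<psi>, OF \<psi>_on]
    define a where "a e n = ((cmod (cinner e (\<phi> n)))\<^sup>2 + (cmod (cinner e (\<psi> n)))\<^sup>2) / 2" for e n
    have a_nn: "0 \<le> a e n" for e n by (simp add: a_def)
    have a_row: "(\<Sum>n\<in>I. a e n) \<le> 1" if "e \<in> E" for e
    proof -
      have "norm e = 1" using E(1) that by (rule orthonormal_norm)
      then have "(\<Sum>n\<in>I. (cmod (cinner e (\<phi> n)))\<^sup>2) \<le> 1" "(\<Sum>n\<in>I. (cmod (cinner e (\<psi> n)))\<^sup>2) \<le> 1"
        using bessel_le[OF \<phi>_image(1), of e] bessel_le[OF \<psi>_image(1), of e] I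
        by (simp_all add: sum.reindex[OF \<phi>_image(2)] sum.reindex[OF \<psi>_image(2)])
      moreover have "(\<Sum>n\<in>I. a e n) =
          ((\<Sum>n\<in>I. (cmod (cinner e (\<phi> n)))\<^sup>2) + (\<Sum>n\<in>I. (cmod (cinner e (\<psi> n)))\<^sup>2)) / 2"
        by (simp add: a_def sum.distrib flip: sum_divide_distrib)
      ultimately show ?thesis by simp
    qed
    have a_col: "(\<Sum>e\<in>E. a e n) \<le> 1" if "n \<in> I" for n
    proof -
      have swap: "cmod (cinner e x) = cmod (cinner x e)" for e x :: 'a
        by (metis cinner_commute complex_mod_cnj)
      have "norm (\<phi> n) = 1" "norm (\<psi> n) = 1"
        using orthonormal_norm \<phi>_image(1) \<psi>_image(1) that by blast+
      then have "(\<Sum>e\<in>E. (cmod (cinner e (\<phi> n)))\<^sup>2) \<le> 1" "(\<Sum>e\<in>E. (cmod (cinner e (\<psi> n)))\<^sup>2) \<le> 1"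
        using bessel_le[OF E, of "\<phi> n"] bessel_le[OF E, of "\<psi> n"]
        unfolding swap[of _ "\<phi> n"] swap[of _ "\<psi> n"] by simp_all
      moreover have "(\<Sum>e\<in>E. a e n) =
          ((\<Sum>e\<in>E. (cmod (cinner e (\<phi> n)))\<^sup>2) + (\<Sum>e\<in>E. (cmod (cinner e (\<psi> n)))\<^sup>2)) / 2"
        by (simp add: a_def sum.distrib flip: sum_divide_distrib)
      ultimately show ?thesis by simp
    qed
    have c_le: "c e - s N \<le> (\<Sum>n\<in>I. a e n * s n)" if e: "e \<in> E" for e
    proof -
      have e1: "norm e = 1" using E(1) e by (rule orthonormal_norm)
      define q where "q = (\<Sum>f\<in>\<phi> ` I. cinner e f *\<^sub>C f)"
      have q: "q = (\<Sum>n\<in>I. cinner e (\<phi> n) *\<^sub>C \<phi> n)"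
        unfolding q_def by (simp add: sum.reindex[OF \<phi>_image(2)])
      have "cinner (e - q) (\<phi> m) = 0" if "m < N" for m
      proof (cases "s m = 0")
        case True
        then have "\<phi> m = 0" using nrm[of m] by simp
        then show ?thesis by simp
      next
        case False
        then have "\<phi> m \<in> \<phi> ` I" using that by (auto simp: I_def)
        then show ?thesis
          unfolding q_def by (intro residual_orthogonal[OF \<phi>_image(1)]) (use I in auto)
      qed
      then have "norm (K (e - q)) \<le> s N * norm (e - q)" by (intro max) simp
      moreover have "norm (e - q) \<le> 1"
      proof -
        have "(norm (e - q))\<^sup>2 \<le> 1\<^sup>2"
          using bessel[OF \<phi>_image(1), of e] I e1 sum_nonneg[of "\<phi> ` I" "\<lambda>f. (cmod (cinner e f))\<^sup>2"]
          by (simp add: q_def)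
        then show ?thesis by (rule power2_le_imp_le) simp
      qed
      ultimately have "norm (K (e - q)) \<le> s N"
        using nn[of N] mult_left_mono[of "norm (e - q)" 1 "s N"] by linarith
      then have rest: "cmod (cinner (K (e - q)) e) \<le> s N"
        using cauchy_schwarz[of "K (e - q)" e] e1 by simp
      have "K (\<phi> n) = complex_of_real (s n) *\<^sub>C \<psi> n" if "n \<in> I" for n
        using that by (simp add: \<psi>_def scaleC_scaleC scaleC_one I_def)
      then have "cinner (K q) e = (\<Sum>n\<in>I. complex_of_real (s n) * (cinner e (\<phi> n) * cinner (\<psi> n) e))"
        unfolding q clinear_sum[OF cl] cinner_sum_left
        by (intro sum.cong refl) (simp add: clinear_scale[OF cl] cinner_scaleC_left mult_ac)
      also have "cmod \<dots> \<le> (\<Sum>n\<in>I. a e n * s n)"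
      proof (rule sum_norm_le)
        fix n
        have swap: "cmod (cinner (\<psi> n) e) = cmod (cinner e (\<psi> n))"
          by (metis cinner_commute complex_mod_cnj)
        have "cmod (cinner e (\<phi> n)) * cmod (cinner e (\<psi> n)) \<le> a e n"
          using sum_squares_bound[of "cmod (cinner e (\<phi> n))" "cmod (cinner e (\<psi> n))"]
          by (simp add: a_def)
        then have "s n * (cmod (cinner e (\<phi> n)) * cmod (cinner (\<psi> n) e)) \<le> s n * a e n"
          unfolding swap using nn[of n] by (rule mult_left_mono)
        then show "cmod (complex_of_real (s n) * (cinner e (\<phi> n) * cinner (\<psi> n) e)) \<le> a e n * s n"
          using nn[of n] by (simp add: norm_mult mult.commute)
      qed
      finally have main: "cmod (cinner (K q) e) \<le> (\<Sum>n\<in>I. a e n * s n)" .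
      have "cinner (K e) e = cinner (K q) e + cinner (K (e - q)) e"
        by (simp add: clinear_diff[OF cl] cinner_diff_left)
      then have "c e \<le> cmod (cinner (K q) e) + cmod (cinner (K (e - q)) e)"
        unfolding c_def by (metis norm_triangle_ineq)
      then show ?thesis using main rest by linarith
    qed
    have "(\<Sum>e\<in>E. (max 0 (c e - s N)) powr p) \<le> (\<Sum>e\<in>E. \<Sum>n\<in>I. a e n * s n powr p)"
    proof (rule sum_mono)
      fix e assume e: "e \<in> E"
      have "0 \<le> (\<Sum>n\<in>I. a e n * s n)" using a_nn nn by (intro sum_nonneg mult_nonneg_nonneg)
      then have "(max 0 (c e - s N)) powr p \<le> (\<Sum>n\<in>I. a e n * s n) powr p"
        using c_le[OF e] p by (intro powr_mono2) auto
      also have "\<dots> \<le> (\<Sum>n\<in>I. a e n * s n powr p)"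
        using a_nn a_row[OF e] nn by (intro powr_sum_le_subconvex[OF p])
      finally show "(max 0 (c e - s N)) powr p \<le> (\<Sum>n\<in>I. a e n * s n powr p)" .
    qed
    also have "\<dots> = (\<Sum>n\<in>I. (\<Sum>e\<in>E. a e n) * s n powr p)"
      by (subst sum.swap) (simp add: sum_distrib_right)
    also have "\<dots> \<le> (\<Sum>n\<in>I. 1 * s n powr p)"
      using a_col by (intro sum_mono mult_right_mono) auto
    also have "\<dots> \<le> S"
      unfolding S_def using summ I by (simp add: s_def sum_le_suminf)
    finally show ?thesis .
  qed
  have "(\<lambda>N. \<Sum>e\<in>E. (max 0 (c e - s N)) powr p) \<longlonglongrightarrow> (\<Sum>e\<in>E. (max 0 (c e - 0)) powr p)"
    using p by (intro tendsto_sum tendsto_powr2 tendsto_max tendsto_diff tendsto_const lim) auto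
  then have "(\<Sum>e\<in>E. (max 0 (c e - 0)) powr p) \<le> S"
    using bound by (intro LIMSEQ_le_const2) auto
  then show ?thesis
    by (simp add: c_def S_def s_def max_def)
qed


section \<open>Triangular orthonormal systems\<close>

text \<open>Each vector of a triangular system is added orthogonally to the earlier ones, which span an
  invariant subspace; its diagonal entry \<open>c\<close> is then \<open>cinner (T e) e\<close>.\<close>

inductive schur_system :: "('a :: complex_hilbert_space \<Rightarrow> 'a) \<Rightarrow> 'a set \<Rightarrow> bool" for T
  where
    empty: "schur_system T {}"
  | insert: "schur_system T E \<Longrightarrow> norm e = 1 \<Longrightarrow> (\<And>f. f \<in> E \<Longrightarrow> cinner f e = 0) \<Longrightarrow>
      T e - c *\<^sub>C e \<in> cspan E \<Longrightarrow> schur_system T (insert e E)"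

lemma schur_system_finite: "schur_system T E \<Longrightarrow> finite E"
  by (induction rule: schur_system.induct) auto

lemma schur_system_orthonormal: "schur_system T E \<Longrightarrow> orthonormal E"
proof (induction rule: schur_system.induct)
  case (insert E e c)
  then show ?case
    unfolding orthonormal_def by (metis cinner_eq_zero_commute insert_iff)
qed (simp add: orthonormal_def)

lemma schur_system_invariant:
  assumes "clinear T" "schur_system T E" "v \<in> cspan E"
  shows "T v \<in> cspan E"
  using assms(2,3)
proof (induction arbitrary: v rule: schur_system.induct)
  case empty
  then show ?case by (simp add: clinear_zero[OF assms(1)])
next
  case (insert E e c)
  obtain k where k: "v - k *\<^sub>C e \<in> cspan E"
    using insert.prems complex_vector.span_breakdown_eq by metis
  have mono: "x \<in> cspan E \<Longrightarrow> x \<in> cspan (insert e E)" for x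
    using complex_vector.span_mono[of E "insert e E"] by blast
  have e: "e \<in> cspan (insert e E)" by (simp add: complex_vector.span_base)
  have "T v = T (v - k *\<^sub>C e) + k *\<^sub>C ((T e - c *\<^sub>C e) + c *\<^sub>C e)"
    by (simp add: clinear_diff[OF assms(1)] clinear_scale[OF assms(1)])
  also have "\<dots> \<in> cspan (insert e E)"
    using insert.IH[OF k] insert.hyps(4) e mono
    by (intro complex_vector.span_add complex_vector.span_scale) auto
  finally show ?case .
qed

lemma clinear_shift: "clinear T \<Longrightarrow> clinear (\<lambda>x. T x - \<mu> *\<^sub>C x)"
  by (intro clinearI)
    (simp_all add: clinear_add clinear_scale complex_vector.scale_right_diff_distrib
      scaleC_add_right scaleC_scaleC mult.commute)

text \<open>The chain \<open>(T - \<mu>)\<^sup>k v, (T - \<mu>)\<^sup>k\<^sup>-\<^sup>1 v, \<dots>, v\<close> is orthonormalised starting from its zero end.\<close>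

lemma schur_system_extend:
  assumes T: "clinear T"
  shows "schur_system T E \<Longrightarrow> ((\<lambda>x. T x - \<mu> *\<^sub>C x) ^^ k) v = 0 \<Longrightarrow>
    \<exists>E'. schur_system T E' \<and> E \<subseteq> E' \<and> v \<in> cspan E'"
proof (induction k arbitrary: v)
  case 0
  then show ?case by (auto intro: complex_vector.span_zero)
next
  case (Suc k)
  define N where "N = (\<lambda>x. T x - \<mu> *\<^sub>C x)"
  have N: "clinear N" unfolding N_def by (rule clinear_shift[OF T])
  have "(N ^^ k) (N v) = 0"
    using Suc.prems(2) unfolding N_def by (simp only: funpow_Suc_right o_apply)
  then obtain E' where E': "schur_system T E'" "E \<subseteq> E'" "N v \<in> cspan E'"
    using Suc.IH[of "N v"] Suc.prems(1) unfolding N_def by blast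
  show ?case
  proof (cases "v \<in> cspan E'")
    case True
    then show ?thesis using E' by blast
  next
    case False
    define q where "q = (\<Sum>e\<in>E'. cinner v e *\<^sub>C e)"
    define u where "u = v - q"
    have q: "q \<in> cspan E'" unfolding q_def
      by (intro complex_vector.span_sum complex_vector.span_scale complex_vector.span_base)
    then have "u \<noteq> 0" using False by (auto simp: u_def)
    define e where "e = complex_of_real (1 / norm u) *\<^sub>C u"
    have "norm e = 1"
      using \<open>u \<noteq> 0\<close> by (simp add: e_def norm_scaleC norm_divide)
    moreover have "cinner f e = 0" if "f \<in> E'" for f
    proof -
      have "cinner u f = 0"
        unfolding u_def q_def
        by (rule residual_orthogonal[OF schur_system_orthonormal[OF E'(1)]
              schur_system_finite[OF E'(1)] that])
      then show ?thesis
        by (simp add: e_def cinner_scaleC_right cinner_eq_zero_commute[of f])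
    qed
    moreover have "N e \<in> cspan E'"
    proof -
      have "N q \<in> cspan E'"
        unfolding N_def
        by (intro complex_vector.span_diff complex_vector.span_scale q
            schur_system_invariant[OF T E'(1)])
      then have "complex_of_real (1 / norm u) *\<^sub>C (N v - N q) \<in> cspan E'"
        using E'(3) by (intro complex_vector.span_scale complex_vector.span_diff)
      then show ?thesis
        by (simp only: e_def u_def clinear_scale[OF N] clinear_diff[OF N])
    qed
    ultimately have "schur_system T (insert e E')"
      using E'(1) unfolding N_def by (intro schur_system.insert)
    moreover have "v \<in> cspan (insert e E')"
    proof -
      have "complex_of_real (norm u) *\<^sub>C e = u"
        using \<open>u \<noteq> 0\<close> by (simp add: e_def scaleC_scaleC scaleC_one)
      then have "v - complex_of_real (norm u) *\<^sub>C e = q" by (simp add: u_def)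
      then show ?thesis using q complex_vector.span_breakdown_eq by metis
    qed
    ultimately show ?thesis using E'(2) by blast
  qed
qed

lemma schur_system_covering:
  assumes T: "clinear T" and "finite B"
    and "\<And>b. b \<in> B \<Longrightarrow> \<exists>\<mu> k. ((\<lambda>x. T x - \<mu> *\<^sub>C x) ^^ k) b = 0"
  shows "\<exists>E. schur_system T E \<and> B \<subseteq> cspan E"
  using assms(2,3)
proof (induction B rule: finite_induct)
  case empty
  then show ?case using schur_system.empty by blast
next
  case (insert b B)
  then obtain E where E: "schur_system T E" "B \<subseteq> cspan E" by blast
  obtain \<mu> k where "((\<lambda>x. T x - \<mu> *\<^sub>C x) ^^ k) b = 0" using insert.prems by blast
  then obtain E' where "schur_system T E'" "E \<subseteq> E'" "b \<in> cspan E'"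
    using schur_system_extend[OF T E(1)] by blast
  then show ?case
    using E(2) complex_vector.span_mono[of E E'] by blast
qed

text \<open>Modulo the earlier vectors, \<open>(T - \<mu>)\<^sup>k\<close> multiplies the coefficient of the last vector \<open>e\<close> by
  \<open>(c - \<mu>)\<^sup>k\<close>. For a generalised eigenvector that coefficient vanishes unless \<open>c = \<mu>\<close>, so only
  diagonal entries equal to \<open>\<mu>\<close> contribute to the dimension of \<open>V\<close>.\<close>

lemma schur_system_count:
  assumes T: "clinear T" and "schur_system T E" "csubspace V" "V \<subseteq> cspan E"
    and "\<And>v. v \<in> V \<Longrightarrow> \<exists>k. ((\<lambda>x. T x - \<mu> *\<^sub>C x) ^^ k) v = 0"
  shows "\<exists>W. finite W \<and> card W \<le> card {e\<in>E. cinner (T e) e = \<mu>} \<and> V \<subseteq> cspan W"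
  using assms(2-)
proof (induction arbitrary: V rule: schur_system.induct)
  case empty
  then show ?case by (intro exI[of _ "{}"]) auto
next
  case (insert E e c)
  define N where "N = (\<lambda>x. T x - \<mu> *\<^sub>C x)"
  have N: "clinear N" unfolding N_def by (rule clinear_shift[OF T])
  have fin: "finite E" using schur_system_finite insert.hyps(1) .
  have ortho: "cinner w e = 0" if "w \<in> cspan E" for w
    using that insert.hyps(3) by (rule orthogonal_to_span)
  have ee: "cinner e e = 1" using insert.hyps(2) by (simp add: cinner_self)
  have "e \<notin> E" using insert.hyps(3) ee by force
  have diag: "cinner (T e) e = c"
    using ortho[OF insert.hyps(4)] by (simp add: cinner_diff_left cinner_scaleC_left ee)
  show ?case
  proof (cases "V \<subseteq> cspan E")
    case True
    then obtain W where W: "finite W" "card W \<le> card {f\<in>E. cinner (T f) f = \<mu>}" "V \<subseteq> cspan W"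
      using insert.IH[OF insert.prems(1) True insert.prems(3)] by blast
    moreover have "card {f\<in>E. cinner (T f) f = \<mu>} \<le> card {f\<in>insert e E. cinner (T f) f = \<mu>}"
      using fin by (intro card_mono) auto
    ultimately show ?thesis using order_trans by blast
  next
    case False
    then obtain v\<^sub>0 where v\<^sub>0: "v\<^sub>0 \<in> V" "v\<^sub>0 \<notin> cspan E" by blast
    then obtain \<beta> where \<beta>: "v\<^sub>0 - \<beta> *\<^sub>C e \<in> cspan E"
      using insert.prems(2) complex_vector.span_breakdown_eq by blast
    have "\<beta> \<noteq> 0" using \<beta> v\<^sub>0(2) by auto
    have power: "(N ^^ k) v\<^sub>0 - (\<beta> * (c - \<mu>) ^ k) *\<^sub>C e \<in> cspan E" for k
    proof (induction k)
      case 0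
      then show ?case using \<beta> by simp
    next
      case (Suc k)
      define \<gamma> where "\<gamma> = \<beta> * (c - \<mu>) ^ k"
      define y where "y = (N ^^ k) v\<^sub>0 - \<gamma> *\<^sub>C e"
      have y: "y \<in> cspan E" using Suc by (simp add: y_def \<gamma>_def)
      have "(N ^^ Suc k) v\<^sub>0 = N y + \<gamma> *\<^sub>C N e"
        by (simp add: y_def clinear_diff[OF N] clinear_scale[OF N])
      then have "(N ^^ Suc k) v\<^sub>0 - (\<beta> * (c - \<mu>) ^ Suc k) *\<^sub>C e = N y + \<gamma> *\<^sub>C (T e - c *\<^sub>C e)"
        by (simp add: N_def \<gamma>_def algebra_simps scaleC_scaleC
            complex_vector.scale_right_diff_distrib complex_vector.scale_left_diff_distrib)
      also have "N y \<in> cspan E"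
        unfolding N_def using y
        by (intro complex_vector.span_scale complex_vector.span_diff
            schur_system_invariant[OF T insert.hyps(1)])
      then have "N y + \<gamma> *\<^sub>C (T e - c *\<^sub>C e) \<in> cspan E"
        using insert.hyps(4) by (intro complex_vector.span_add complex_vector.span_scale)
      finally show ?case .
    qed
    obtain k where "(N ^^ k) v\<^sub>0 = 0" using insert.prems(3)[OF v\<^sub>0(1)] unfolding N_def by blast
    then have "\<beta> * (c - \<mu>) ^ k = 0"
      using ortho[OF power[of k]] by (simp add: cinner_diff_left cinner_minus_left cinner_scaleC_left ee)
    then have "c = \<mu>" using \<open>\<beta> \<noteq> 0\<close> by simp
    have "csubspace (V \<inter> cspan E)"
      by (intro complex_vector.subspace_inter complex_vector.subspace_span insert.prems(1))
    then obtain W where W: "finite W" "card W \<le> card {f\<in>E. cinner (T f) f = \<mu>}"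
      "V \<inter> cspan E \<subseteq> cspan W"
      using insert.IH[of "V \<inter> cspan E"] insert.prems(3) by blast
    have "V \<subseteq> cspan (insert v\<^sub>0 W)"
    proof
      fix v assume v: "v \<in> V"
      then obtain \<alpha> where \<alpha>: "v - \<alpha> *\<^sub>C e \<in> cspan E"
        using insert.prems(2) complex_vector.span_breakdown_eq by blast
      have "v - (\<alpha> / \<beta>) *\<^sub>C v\<^sub>0 = (v - \<alpha> *\<^sub>C e) - (\<alpha> / \<beta>) *\<^sub>C (v\<^sub>0 - \<beta> *\<^sub>C e)"
        using \<open>\<beta> \<noteq> 0\<close> by (simp add: complex_vector.scale_right_diff_distrib scaleC_scaleC)
      also have "\<dots> \<in> cspan E"
        by (rule complex_vector.span_diff[OF \<alpha> complex_vector.span_scale[OF \<beta>]])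
      finally have "v - (\<alpha> / \<beta>) *\<^sub>C v\<^sub>0 \<in> V \<inter> cspan E"
        using v v\<^sub>0 insert.prems(1)
        by (simp add: complex_vector.subspace_diff complex_vector.subspace_scale)
      then show "v \<in> cspan (insert v\<^sub>0 W)"
        using W(3) complex_vector.span_breakdown_eq by blast
    qed
    moreover have "card (insert v\<^sub>0 W) \<le> card {f\<in>insert e E. cinner (T f) f = \<mu>}"
    proof -
      have "{f\<in>insert e E. cinner (T f) f = \<mu>} = insert e {f\<in>E. cinner (T f) f = \<mu>}"
        using diag \<open>c = \<mu>\<close> by auto
      then show ?thesis
        using W(1,2) fin \<open>e \<notin> E\<close> by (simp add: card_insert_if)
    qed
    ultimately show ?thesis using W(1) by (intro exI[of _ "insert v\<^sub>0 W"]) simp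
  qed
qed


section \<open>Finite-dimensional invariant subspaces with a single eigenvalue\<close>

lemma clinear_funpow: "clinear (T :: 'a :: complex_hilbert_space \<Rightarrow> 'a) \<Longrightarrow> clinear (T ^^ k)"
proof (induction k)
  case 0
  show ?case by (rule clinearI) simp_all
next
  case (Suc k)
  then show ?case by (intro clinearI) (simp_all add: clinear_add clinear_scale)
qed

text \<open>If \<open>p(T) v = 0\<close> and \<open>p = (X - c) q\<close>, then \<open>q(T)\<close> kills \<open>v' = (T - c) v\<close>, so by induction on the
  degree some power \<open>(T - \<mu>)\<^sup>k\<close> kills \<open>v'\<close>. Hence \<open>w = (T - \<mu>)\<^sup>k v\<close> satisfies \<open>T w = c w\<close>, and
  therefore \<open>w = 0\<close> or \<open>c = \<mu>\<close>.\<close>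

lemma annihilated_imp_generalized_eigenvector:
  assumes T: "clinear T" and V: "csubspace V" "\<And>v. v \<in> V \<Longrightarrow> T v \<in> V"
    and eig: "\<And>w c. w \<in> V \<Longrightarrow> w \<noteq> 0 \<Longrightarrow> T w = c *\<^sub>C w \<Longrightarrow> c = \<mu>"
  shows "p \<noteq> 0 \<Longrightarrow> degree p = n \<Longrightarrow> v \<in> V \<Longrightarrow> (\<Sum>i\<le>n. coeff p i *\<^sub>C (T ^^ i) v) = 0 \<Longrightarrow>
    \<exists>k. ((\<lambda>x. T x - \<mu> *\<^sub>C x) ^^ k) v = 0"
proof (induction n arbitrary: p v)
  case 0
  then have "coeff p 0 \<noteq> 0" by (metis leading_coeff_0_iff)
  then have "v = 0" using 0 by simp
  then show ?case by (intro exI[of _ 0]) simp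
next
  case (Suc n)
  define N where "N = (\<lambda>x. T x - \<mu> *\<^sub>C x)"
  have N: "clinear N" unfolding N_def by (rule clinear_shift[OF T])
  have "\<not> constant (poly p)" using Suc.prems(2) by (simp add: constant_degree)
  then obtain c where "poly p c = 0" using fundamental_theorem_of_algebra by blast
  then obtain q where q: "p = [:-c, 1:] * q" by (auto simp: poly_eq_0_iff_dvd dvd_def)
  then have "q \<noteq> 0" using Suc.prems(1) by auto
  then have deg: "degree q = n"
    using Suc.prems(2) degree_mult_eq[of "[:-c, 1:]" q] q by simp
  have coeff: "coeff p i = coeff (pCons 0 q) i - c * coeff q i" for i
    by (simp add: q)
  have "(\<Sum>i\<le>n. coeff q i *\<^sub>C (T ^^ i) (T v - c *\<^sub>C v)) =
      (\<Sum>i\<le>n. coeff q i *\<^sub>C (T ^^ Suc i) v) - (\<Sum>i\<le>n. (c * coeff q i) *\<^sub>C (T ^^ i) v)"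
    unfolding sum_subtractf[symmetric]
  proof (intro sum.cong refl)
    fix i
    show "coeff q i *\<^sub>C (T ^^ i) (T v - c *\<^sub>C v) =
        coeff q i *\<^sub>C (T ^^ Suc i) v - (c * coeff q i) *\<^sub>C (T ^^ i) v"
      using clinear_funpow[OF T, of i]
      by (simp add: clinear_diff clinear_scale complex_vector.scale_right_diff_distrib
          scaleC_scaleC funpow_swap1 mult.commute)
  qed
  also have "(\<Sum>i\<le>n. coeff q i *\<^sub>C (T ^^ Suc i) v) =
      (\<Sum>i\<le>Suc n. coeff (pCons 0 q) i *\<^sub>C (T ^^ i) v)"
    by (subst sum.atMost_Suc_shift) simp
  also have "(\<Sum>i\<le>n. (c * coeff q i) *\<^sub>C (T ^^ i) v) =
      (\<Sum>i\<le>Suc n. (c * coeff q i) *\<^sub>C (T ^^ i) v)"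
    using coeff_eq_0[of q "Suc n"] deg by simp
  also have "(\<Sum>i\<le>Suc n. coeff (pCons 0 q) i *\<^sub>C (T ^^ i) v) -
      (\<Sum>i\<le>Suc n. (c * coeff q i) *\<^sub>C (T ^^ i) v) = (\<Sum>i\<le>Suc n. coeff p i *\<^sub>C (T ^^ i) v)"
    unfolding sum_subtractf[symmetric] coeff complex_vector.scale_left_diff_distrib ..
  also have "\<dots> = 0" by (rule Suc.prems(4))
  finally have ann: "(\<Sum>i\<le>n. coeff q i *\<^sub>C (T ^^ i) (T v - c *\<^sub>C v)) = 0" .
  have "T v - c *\<^sub>C v \<in> V"
    using Suc.prems(3) V by (simp add: complex_vector.subspace_diff complex_vector.subspace_scale)
  then obtain k where k: "(N ^^ k) (T v - c *\<^sub>C v) = 0"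
    using Suc.IH[OF \<open>q \<noteq> 0\<close> deg _ ann] unfolding N_def by blast
  have commute: "(N ^^ k) (T x) = T ((N ^^ k) x)" for k x
    by (induction k) (simp_all add: N_def clinear_diff[OF T] clinear_scale[OF T])
  have in_V: "(N ^^ k) v \<in> V" for k
    by (induction k) (use Suc.prems(3) V in
        \<open>auto simp: N_def complex_vector.subspace_diff complex_vector.subspace_scale\<close>)
  have "T ((N ^^ k) v) = c *\<^sub>C (N ^^ k) v"
    using k clinear_funpow[OF N, of k] by (simp add: clinear_diff clinear_scale commute)
  then have "(N ^^ k) v = 0 \<or> (N ^^ Suc k) v = 0"
    using eig[OF in_V] by (auto simp: N_def)
  then show ?case unfolding N_def by blast
qed

text \<open>The first iterate \<open>T\<^sup>n v\<close> that depends linearly on the earlier ones gives a monic polynomial.\<close>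

lemma krylov_annihilator:
  fixes T :: "'a :: complex_hilbert_space \<Rightarrow> 'a"
  assumes "finite B" and "\<And>i. (T ^^ i) v \<in> cspan B"
  shows "\<exists>n p. p \<noteq> 0 \<and> degree p = n \<and> (\<Sum>i\<le>n. coeff p i *\<^sub>C (T ^^ i) v) = 0"
proof -
  have "\<exists>n. (T ^^ n) v \<in> cspan ((\<lambda>i. (T ^^ i) v) ` {..<n})"
  proof (rule ccontr)
    assume "\<nexists>n. (T ^^ n) v \<in> cspan ((\<lambda>i. (T ^^ i) v) ` {..<n})"
    then have new: "(T ^^ n) v \<notin> cspan ((\<lambda>i. (T ^^ i) v) ` {..<n})" for n by blast
    have "\<not> complex_vector.dependent ((\<lambda>i. (T ^^ i) v) ` {..<n}) \<and>
        card ((\<lambda>i. (T ^^ i) v) ` {..<n}) = n" for n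
    proof (induction n)
      case (Suc n)
      have "(T ^^ n) v \<notin> (\<lambda>i. (T ^^ i) v) ` {..<n}"
        using new[of n] complex_vector.span_base[of "(T ^^ n) v"] by metis
      then show ?case
        using Suc new[of n]
        by (simp only: lessThan_Suc image_insert complex_vector.independent_insert card_insert_disjoint
            finite_imageI finite_lessThan if_False simp_thms)
    qed (simp add: complex_vector.independent_empty)
    then show False
      using complex_vector.independent_span_bound[OF assms(1),
          of "(\<lambda>i. (T ^^ i) v) ` {..<Suc (card B)}"] assms(2)
      by (metis (no_types, lifting) Suc_n_not_le_n image_subsetI)
  qed
  then obtain n where n: "(T ^^ n) v \<in> cspan ((\<lambda>i. (T ^^ i) v) ` {..<n})" by blast
  have "cspan ((\<lambda>i. (T ^^ i) v) ` {..<n}) \<subseteq> {\<Sum>i<n. g i *\<^sub>C (T ^^ i) v |g. True}" (is "_ \<subseteq> ?X")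
  proof (rule complex_vector.span_minimal)
    show "(\<lambda>i. (T ^^ i) v) ` {..<n} \<subseteq> ?X"
    proof safe
      fix j assume "j < n"
      then have "(T ^^ j) v = (\<Sum>i<n. (if i = j then 1 else 0) *\<^sub>C (T ^^ i) v)"
        by (simp add: if_distrib[of "\<lambda>c. c *\<^sub>C _"] scaleC_one cong: if_cong)
      then show "\<exists>g. (T ^^ j) v = (\<Sum>i<n. g i *\<^sub>C (T ^^ i) v) \<and> True"
        by (intro exI[of _ "\<lambda>i. if i = j then 1 else 0"]) simp
    qed
    show "csubspace ?X"
      unfolding complex_vector.subspace_def
    proof safe
      show "\<exists>g. 0 = (\<Sum>i<n. g i *\<^sub>C (T ^^ i) v) \<and> True" by (intro exI[of _ "\<lambda>i. 0"]) simp
      fix g h c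
      show "\<exists>r. (\<Sum>i<n. g i *\<^sub>C (T ^^ i) v) + (\<Sum>i<n. h i *\<^sub>C (T ^^ i) v) =
          (\<Sum>i<n. r i *\<^sub>C (T ^^ i) v) \<and> True"
        by (intro exI[of _ "\<lambda>i. g i + h i"]) (simp add: scaleC_add_left sum.distrib)
      show "\<exists>r. c *\<^sub>C (\<Sum>i<n. g i *\<^sub>C (T ^^ i) v) = (\<Sum>i<n. r i *\<^sub>C (T ^^ i) v) \<and> True"
        by (intro exI[of _ "\<lambda>i. c * g i"]) (simp add: complex_vector.scale_sum_right scaleC_scaleC)
    qed
  qed
  then obtain g where g: "(T ^^ n) v = (\<Sum>i<n. g i *\<^sub>C (T ^^ i) v)" using n by blast
  define p where "p = monom 1 n - (\<Sum>i<n. monom (g i) i)"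
  have coeff: "coeff p j = (if j = n then 1 else if j < n then - g j else 0)" for j
    by (simp add: p_def coeff_sum)
  have "p \<noteq> 0" using coeff[of n] by force
  moreover have "degree p = n"
    by (intro antisym degree_le le_degree) (auto simp: coeff)
  moreover have "(\<Sum>i\<le>n. coeff p i *\<^sub>C (T ^^ i) v) = 0"
    by (simp add: lessThan_Suc_atMost[symmetric] coeff scaleC_one g sum_negf)
  ultimately show ?thesis by blast
qed

lemma single_eigenvalue_imp_generalized_eigenvectors:
  assumes T: "clinear T" and V: "csubspace V" "\<And>v. v \<in> V \<Longrightarrow> T v \<in> V"
    and fin: "finite B" "V \<subseteq> cspan B"
    and eig: "\<And>w c. w \<in> V \<Longrightarrow> w \<noteq> 0 \<Longrightarrow> T w = c *\<^sub>C w \<Longrightarrow> c = \<mu>"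
    and v: "v \<in> V"
  shows "\<exists>k. ((\<lambda>x. T x - \<mu> *\<^sub>C x) ^^ k) v = 0"
proof -
  have "(T ^^ i) v \<in> V" for i by (induction i) (use v V(2) in auto)
  then have "(T ^^ i) v \<in> cspan B" for i using fin(2) by (rule set_mp[rotated])
  from krylov_annihilator[OF fin(1) this]
  obtain n p where "p \<noteq> 0" "degree p = n" "(\<Sum>i\<le>n. coeff p i *\<^sub>C (T ^^ i) v) = 0" by blast
  then show ?thesis
    by (intro annihilated_imp_generalized_eigenvector[OF T V eig _ _ v])
qed


section \<open>Resolvents\<close>

lemma resolvent_dom: "z \<in> resolvent_set Z \<Longrightarrow> resolvent Z z x \<in> op_dom Z"
  unfolding resolvent_def resolvent_set_def bij_betw_def
  by (auto intro: inv_into_into)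

lemma resolvent_right_inverse:
  "z \<in> resolvent_set Z \<Longrightarrow> z *\<^sub>C resolvent Z z x - op_fun Z (resolvent Z z x) = x"
  unfolding resolvent_def resolvent_set_def bij_betw_def
  using f_inv_into_f[of x "\<lambda>x. z *\<^sub>C x - op_fun Z x" "op_dom Z"] by auto

lemma resolvent_left_inverse:
  "z \<in> resolvent_set Z \<Longrightarrow> u \<in> op_dom Z \<Longrightarrow> resolvent Z z (z *\<^sub>C u - op_fun Z u) = u"
  unfolding resolvent_def resolvent_set_def bij_betw_def
  using inv_into_f_f[of "\<lambda>x. z *\<^sub>C x - op_fun Z x" "op_dom Z" u] by auto

lemma resolvent_eqI:
  "z \<in> resolvent_set Z \<Longrightarrow> u \<in> op_dom Z \<Longrightarrow> z *\<^sub>C u - op_fun Z u = x \<Longrightarrow> resolvent Z z x = u"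
  using resolvent_left_inverse by blast

lemma bounded_linear_resolvent: "z \<in> resolvent_set Z \<Longrightarrow> bounded_linear (resolvent Z z)"
  by (simp add: resolvent_set_def)

lemma clinear_resolvent:
  assumes "linear_op Z" "z \<in> resolvent_set Z"
  shows "clinear (resolvent Z z)"
proof (rule clinearI)
  fix x y c
  note dom = resolvent_dom[OF assms(2)] and inv = resolvent_right_inverse[OF assms(2)]
  have sub: "csubspace (op_dom Z)"
    and add: "\<And>x y. x \<in> op_dom Z \<Longrightarrow> y \<in> op_dom Z \<Longrightarrow> op_fun Z (x + y) = op_fun Z x + op_fun Z y"
    and scale: "\<And>c x. x \<in> op_dom Z \<Longrightarrow> op_fun Z (c *\<^sub>C x) = c *\<^sub>C op_fun Z x"
    using assms(1) by (auto simp: linear_op_def)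
  show "resolvent Z z (x + y) = resolvent Z z x + resolvent Z z y"
  proof (rule resolvent_eqI[OF assms(2)])
    show "resolvent Z z x + resolvent Z z y \<in> op_dom Z"
      using sub dom by (intro complex_vector.subspace_add)
    show "z *\<^sub>C (resolvent Z z x + resolvent Z z y) - op_fun Z (resolvent Z z x + resolvent Z z y) = x + y"
      using inv[of x] inv[of y] by (simp add: add dom scaleC_add_right algebra_simps)
  qed
  show "resolvent Z z (c *\<^sub>C x) = c *\<^sub>C resolvent Z z x"
  proof (rule resolvent_eqI[OF assms(2)])
    show "c *\<^sub>C resolvent Z z x \<in> op_dom Z"
      using sub dom by (intro complex_vector.subspace_scale)
    have "z *\<^sub>C c *\<^sub>C resolvent Z z x - op_fun Z (c *\<^sub>C resolvent Z z x) =
        c *\<^sub>C (z *\<^sub>C resolvent Z z x - op_fun Z (resolvent Z z x))"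
      by (simp add: scale dom complex_vector.scale_right_diff_distrib scaleC_scaleC mult.commute)
    then show "z *\<^sub>C c *\<^sub>C resolvent Z z x - op_fun Z (c *\<^sub>C resolvent Z z x) = c *\<^sub>C x"
      by (simp add: inv)
  qed
qed

lemma resolvent_identity:
  assumes "linear_op Z" "z \<in> resolvent_set Z" "w \<in> resolvent_set Z"
  shows "resolvent Z w x - resolvent Z z x = (z - w) *\<^sub>C resolvent Z z (resolvent Z w x)"
proof -
  let ?u = "resolvent Z w x"
  note lin = clinear_resolvent[OF assms(1,2)]
  have "?u = resolvent Z z (z *\<^sub>C ?u - op_fun Z ?u)"
    by (rule resolvent_left_inverse[OF assms(2) resolvent_dom[OF assms(3)], symmetric])
  also have "z *\<^sub>C ?u - op_fun Z ?u = x + (z - w) *\<^sub>C ?u"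
    using resolvent_right_inverse[OF assms(3), of x]
    by (simp add: complex_vector.scale_left_diff_distrib algebra_simps)
  also have "resolvent Z z \<dots> = resolvent Z z x + (z - w) *\<^sub>C resolvent Z z ?u"
    by (simp add: clinear_add[OF lin] clinear_scale[OF lin])
  finally show ?thesis by (simp add: algebra_simps)
qed

lemma resolvent_commute:
  assumes "linear_op Z" "z \<in> resolvent_set Z" "w \<in> resolvent_set Z"
  shows "resolvent Z z (resolvent Z w x) = resolvent Z w (resolvent Z z x)"
proof (cases "z = w")
  case False
  have "(z - w) *\<^sub>C resolvent Z z (resolvent Z w x) = - ((w - z) *\<^sub>C resolvent Z w (resolvent Z z x))"
    using resolvent_identity[OF assms(1,2,3), of x] resolvent_identity[OF assms(1,3,2), of x]
    by (metis minus_diff_eq)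
  also have "\<dots> = (z - w) *\<^sub>C resolvent Z w (resolvent Z z x)"
    by (metis complex_vector.scale_minus_left minus_diff_eq)
  finally show ?thesis using False by (simp add: complex_vector.scale_left_imp_eq)
qed simp

text \<open>In \<open>R\<^sub>z = R\<^sub>w + (w - z) R\<^sub>w R\<^sub>z\<close> the last term is at most half of \<open>R\<^sub>z\<close> and can be absorbed.\<close>

lemma resolvent_locally_bounded:
  assumes "linear_op Z" "z \<in> resolvent_set Z" "w \<in> resolvent_set Z"
    and M: "\<And>x. norm (resolvent Z w x) \<le> norm x * M" and near: "cmod (z - w) * M \<le> 1 / 2"
  shows "norm (resolvent Z z x) \<le> norm x * (2 * M)"
proof -
  let ?u = "resolvent Z z x"
  have "norm (resolvent Z w ?u) * cmod (w - z) \<le> (norm ?u * M) * cmod (z - w)"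
    using M[of ?u] by (simp add: mult_right_mono norm_minus_commute)
  also have "\<dots> \<le> norm ?u * (1 / 2)"
    using mult_left_mono[OF near, of "norm ?u"] by (simp add: mult_ac)
  finally have *: "norm ((w - z) *\<^sub>C resolvent Z w ?u) \<le> norm ?u * (1 / 2)"
    by (simp add: norm_scaleC mult.commute)
  have "?u = resolvent Z w x + (w - z) *\<^sub>C resolvent Z w ?u"
    using resolvent_identity[OF assms(1,3,2), of x] by (simp add: algebra_simps)
  then have "norm ?u \<le> norm (resolvent Z w x) + norm ((w - z) *\<^sub>C resolvent Z w ?u)"
    by (metis norm_triangle_ineq)
  then show ?thesis using * M[of x] by linarith
qed

lemma resolvent_norm_bound:
  assumes "linear_op Z" "w \<in> resolvent_set Z"
  obtains M where "0 < M" "\<And>x. norm (resolvent Z w x) \<le> norm x * M"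
  using bounded_linear.pos_bounded[OF bounded_linear_resolvent[OF assms(2)]] by blast

text \<open>For \<open>\<bar>z - w\<bar> \<parallel>R\<^sub>w\<parallel> \<le> 1/2\<close> the equation \<open>(z - Z) u = y\<close> reads \<open>u = R\<^sub>w y + (w - z) R\<^sub>w u\<close>, a
  contraction.\<close>

lemma open_resolvent_set:
  assumes Z: "linear_op Z"
  shows "open (resolvent_set Z)"
  unfolding open_dist
proof
  fix w assume w: "w \<in> resolvent_set Z"
  obtain M where "0 < M" and M: "\<And>x. norm (resolvent Z w x) \<le> norm x * M"
    using resolvent_norm_bound[OF Z w] by blast
  note lin = clinear_resolvent[OF Z w]
  have sub: "csubspace (op_dom Z)" using Z by (simp add: linear_op_def)
  have "z \<in> resolvent_set Z" if z: "dist z w < 1 / (2 * M)" for z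
  proof -
    have near: "cmod (z - w) * M \<le> 1 / 2"
      using z \<open>0 < M\<close> by (simp add: dist_norm field_simps)
    have contraction: "norm ((w - z) *\<^sub>C resolvent Z w x) \<le> 1 / 2 * norm x" for x
    proof -
      have "cmod (w - z) * norm (resolvent Z w x) \<le> cmod (z - w) * (norm x * M)"
        using M[of x] by (simp add: mult_left_mono norm_minus_commute)
      also have "\<dots> \<le> 1 / 2 * norm x"
        using mult_right_mono[OF near, of "norm x"] by (simp add: mult_ac)
      finally show ?thesis by (simp add: norm_scaleC)
    qed
    have equation: "z *\<^sub>C u - op_fun Z u = y \<longleftrightarrow> u = resolvent Z w y + (w - z) *\<^sub>C resolvent Z w u"
      if u: "u \<in> op_dom Z" for u y
    proof
      assume y: "z *\<^sub>C u - op_fun Z u = y"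
      have "u = resolvent Z w (w *\<^sub>C u - op_fun Z u)"
        by (rule resolvent_left_inverse[OF w u, symmetric])
      also have "w *\<^sub>C u - op_fun Z u = y + (w - z) *\<^sub>C u"
        using y by (simp add: complex_vector.scale_left_diff_distrib algebra_simps)
      finally show "u = resolvent Z w y + (w - z) *\<^sub>C resolvent Z w u"
        by (simp add: clinear_add[OF lin] clinear_scale[OF lin])
    next
      assume "u = resolvent Z w y + (w - z) *\<^sub>C resolvent Z w u"
      then have "u = resolvent Z w (y + (w - z) *\<^sub>C u)"
        by (simp add: clinear_add[OF lin] clinear_scale[OF lin])
      then have "w *\<^sub>C u - op_fun Z u = y + (w - z) *\<^sub>C u"
        using resolvent_right_inverse[OF w] by metis
      then show "z *\<^sub>C u - op_fun Z u = y"
        by (simp add: complex_vector.scale_left_diff_distrib algebra_simps)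
    qed
    have solution: "\<exists>!u. resolvent Z w y + (w - z) *\<^sub>C resolvent Z w u = u" for y
    proof -
      have "dist (resolvent Z w y + (w - z) *\<^sub>C resolvent Z w u)
          (resolvent Z w y + (w - z) *\<^sub>C resolvent Z w v) \<le> 1 / 2 * dist u v" for u v
        using contraction[of "u - v"]
        by (simp add: dist_norm clinear_diff[OF lin] complex_vector.scale_right_diff_distrib)
      then have "\<exists>!u\<in>UNIV. resolvent Z w y + (w - z) *\<^sub>C resolvent Z w u = u"
        by (intro Banach_fix[where c = "1 / 2"]) (auto simp: complete_UNIV)
      then show ?thesis by simp
    qed
    have dom: "u \<in> op_dom Z" if "resolvent Z w y + (w - z) *\<^sub>C resolvent Z w u = u" for u y
      using that sub resolvent_dom[OF w]
      by (metis complex_vector.subspace_add complex_vector.subspace_scale)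
    have bij: "bij_betw (\<lambda>x. z *\<^sub>C x - op_fun Z x) (op_dom Z) UNIV"
      unfolding bij_betw_def
    proof
      show "inj_on (\<lambda>x. z *\<^sub>C x - op_fun Z x) (op_dom Z)"
        using equation solution by (intro inj_onI) metis
      show "(\<lambda>x. z *\<^sub>C x - op_fun Z x) ` op_dom Z = UNIV"
      proof (intro equalityI subset_UNIV subsetI)
        fix y
        obtain u where u: "resolvent Z w y + (w - z) *\<^sub>C resolvent Z w u = u"
          using solution by blast
        then have "y = z *\<^sub>C u - op_fun Z u"
          using equation[OF dom[OF u], of y] by simp
        then show "y \<in> (\<lambda>x. z *\<^sub>C x - op_fun Z x) ` op_dom Z"
          by (rule image_eqI) (rule dom[OF u])
      qed
    qed
    have "resolvent Z z y \<in> op_dom Z \<and>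
        z *\<^sub>C resolvent Z z y - op_fun Z (resolvent Z z y) = y" for y
      using bij f_inv_into_f[of y "\<lambda>x. z *\<^sub>C x - op_fun Z x" "op_dom Z"]
        inv_into_into[of y "\<lambda>x. z *\<^sub>C x - op_fun Z x" "op_dom Z"]
      unfolding resolvent_def bij_betw_def by simp
    then have R: "resolvent Z z y = resolvent Z w y + (w - z) *\<^sub>C resolvent Z w (resolvent Z z y)" for y
      using equation by blast
    have R_unique: "resolvent Z z y = u"
      if "resolvent Z w y + (w - z) *\<^sub>C resolvent Z w u = u" for y u
      using solution[of y] R[of y] that by metis
    have "clinear (resolvent Z z)"
    proof (rule clinearI; rule R_unique)
      fix x y c
      show "resolvent Z w (x + y) + (w - z) *\<^sub>C resolvent Z w (resolvent Z z x + resolvent Z z y) =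
          resolvent Z z x + resolvent Z z y"
        by (subst (3 4) R) (simp add: clinear_add[OF lin] scaleC_add_right)
      show "resolvent Z w (c *\<^sub>C x) + (w - z) *\<^sub>C resolvent Z w (c *\<^sub>C resolvent Z z x) =
          c *\<^sub>C resolvent Z z x"
        by (subst (2) R) (simp add: clinear_scale[OF lin] scaleC_add_right scaleC_scaleC mult.commute)
    qed
    moreover have "norm (resolvent Z z y) \<le> norm y * (2 * M)" for y
    proof -
      have "norm (resolvent Z z y) \<le>
          norm (resolvent Z w y) + norm ((w - z) *\<^sub>C resolvent Z w (resolvent Z z y))"
        by (metis R norm_triangle_ineq)
      then show ?thesis
        using contraction[of "resolvent Z z y"] M[of y] by linarith
    qed
    ultimately have "bounded_linear (resolvent Z z)"
      by (rule clinear_bounded_imp_bounded_linear)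
    then show ?thesis
      using bij by (simp add: resolvent_set_def)
  qed
  then show "\<exists>e>0. \<forall>z. dist z w < e \<longrightarrow> z \<in> resolvent_set Z"
    using \<open>0 < M\<close> by (intro exI[of _ "1 / (2 * M)"]) auto
qed

lemma resolvent_Lipschitz:
  assumes "linear_op Z" "z \<in> resolvent_set Z" "w \<in> resolvent_set Z" "0 < M"
    and M: "\<And>x. norm (resolvent Z w x) \<le> norm x * M" and near: "cmod (z - w) * M \<le> 1 / 2"
  shows "norm (resolvent Z z x - resolvent Z w x) \<le> cmod (z - w) * (2 * M * M) * norm x"
proof -
  have "norm (resolvent Z w (resolvent Z z x)) \<le> norm x * (2 * M) * M"
    using M[of "resolvent Z z x"] resolvent_locally_bounded[OF assms(1,2,3) M near, of x] \<open>0 < M\<close>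
    by (meson less_imp_le mult_right_mono order_trans)
  then have "cmod (w - z) * norm (resolvent Z w (resolvent Z z x)) \<le> cmod (w - z) * (norm x * (2 * M) * M)"
    by (rule mult_left_mono) simp
  then show ?thesis
    unfolding resolvent_identity[OF assms(1,3,2)] norm_scaleC
    by (simp add: mult_ac norm_minus_commute)
qed

lemma continuous_resolvent_Blinfun:
  assumes Z: "linear_op Z" and S: "S \<subseteq> resolvent_set Z"
  shows "continuous_on S (\<lambda>z. Blinfun (resolvent Z z))"
  unfolding continuous_on_iff
proof safe
  fix w and e :: real assume w: "w \<in> S" and "0 < e"
  then have w': "w \<in> resolvent_set Z" using S by blast
  obtain M where "0 < M" and M: "\<And>x. norm (resolvent Z w x) \<le> norm x * M"
    using resolvent_norm_bound[OF Z w'] by blast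
  define \<delta> where "\<delta> = min (1 / (2 * M)) (e / (4 * M * M))"
  have "dist (Blinfun (resolvent Z z)) (Blinfun (resolvent Z w)) < e"
    if z: "z \<in> S" "dist z w < \<delta>" for z
  proof -
    have z': "z \<in> resolvent_set Z" using z S by blast
    have near: "cmod (z - w) * M \<le> 1 / 2"
      using z(2) \<open>0 < M\<close> by (simp add: \<delta>_def dist_norm field_simps)
    have "norm (Blinfun (resolvent Z z) - Blinfun (resolvent Z w)) \<le> cmod (z - w) * (2 * M * M)"
    proof (rule norm_blinfun_bound)
      show "norm (blinfun_apply (Blinfun (resolvent Z z) - Blinfun (resolvent Z w)) x)
          \<le> cmod (z - w) * (2 * M * M) * norm x" for x
        using resolvent_Lipschitz[OF Z z' w' \<open>0 < M\<close> M near, of x]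
        by (simp add: blinfun.diff_left bounded_linear_Blinfun_apply bounded_linear_resolvent z' w')
    qed (use \<open>0 < M\<close> in simp)
    also have "\<dots> \<le> \<delta> * (2 * M * M)"
      using z(2) \<open>0 < M\<close> by (intro mult_right_mono) (auto simp: dist_norm)
    also have "\<dots> \<le> e / (4 * M * M) * (2 * M * M)"
      using \<open>0 < M\<close> by (intro mult_right_mono) (auto simp: \<delta>_def)
    also have "\<dots> < e" using \<open>0 < M\<close> \<open>0 < e\<close> by (simp add: field_simps)
    finally show ?thesis by (simp add: dist_norm)
  qed
  moreover have "0 < \<delta>" using \<open>0 < M\<close> \<open>0 < e\<close> by (simp add: \<delta>_def)
  ultimately show "\<exists>d>0. \<forall>z\<in>S. dist z w < d \<longrightarrow>
      dist (Blinfun (resolvent Z z)) (Blinfun (resolvent Z w)) < e" by blast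
qed

lemma bounded_linear_matrix_coefficient:
  "bounded_linear (\<lambda>B. cinner (blinfun_apply B x) (y :: 'a :: complex_hilbert_space))"
  by (rule bounded_linear_compose[OF bounded_linear_cinner_left]) (rule blinfun.bounded_linear_left)

lemma continuous_resolvent_cinner:
  assumes "linear_op Z" "S \<subseteq> resolvent_set Z"
  shows "continuous_on S (\<lambda>z. cinner (resolvent Z z x) y)"
proof -
  have "continuous_on S (\<lambda>z. cinner (blinfun_apply (Blinfun (resolvent Z z)) x) y)"
    by (rule bounded_linear.continuous_on[OF bounded_linear_matrix_coefficient
          continuous_resolvent_Blinfun[OF assms]])
  then show ?thesis
    by (rule continuous_on_eq)
      (use assms in \<open>simp add: bounded_linear_Blinfun_apply bounded_linear_resolvent subset_iff\<close>)
qed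

text \<open>By the resolvent identity the difference quotient at \<open>w\<close> is minus the matrix coefficient of
  \<open>R\<^sub>z\<close> between \<open>x\<close> and \<open>R\<^sub>w\<^sup>* y\<close>, so continuity of all coefficients gives differentiability.\<close>

lemma holomorphic_resolvent_cinner:
  assumes Z: "linear_op Z" and S: "S \<subseteq> resolvent_set Z"
  shows "(\<lambda>z. cinner (resolvent Z z x) y) holomorphic_on S"
  unfolding holomorphic_on_def field_differentiable_def
proof
  fix w assume w: "w \<in> S"
  then have w': "w \<in> resolvent_set Z" using S by blast
  note bl = bounded_linear_resolvent[OF w'] and cl = clinear_resolvent[OF Z w']
  define y' where "y' = bounded_adjoint (resolvent Z w) y"
  have quotient: "(cinner (resolvent Z z x) y - cinner (resolvent Z w x) y) / (z - w) =
      - cinner (resolvent Z z x) y'" if "z \<in> S" "z \<noteq> w" for z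
  proof -
    have z: "z \<in> resolvent_set Z" using that S by blast
    have "cinner (resolvent Z z x) y - cinner (resolvent Z w x) y =
        (w - z) * cinner (resolvent Z w (resolvent Z z x)) y"
      using resolvent_identity[OF Z w' z, of x] by (metis cinner_diff_left cinner_scaleC_left)
    also have "\<dots> = (w - z) * cinner (resolvent Z z x) y'"
      by (simp add: y'_def cinner_bounded_adjoint[OF bl cl])
    finally show ?thesis using that(2) by (simp add: field_simps)
  qed
  have "((\<lambda>z. - cinner (resolvent Z z x) y') \<longlongrightarrow> - cinner (resolvent Z w x) y') (at w within S)"
    using continuous_resolvent_cinner[OF assms, of x y'] w
    by (intro tendsto_minus) (simp add: continuous_on_def)
  then have "((\<lambda>z. (cinner (resolvent Z z x) y - cinner (resolvent Z w x) y) / (z - w))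
      \<longlongrightarrow> - cinner (resolvent Z w x) y') (at w within S)"
    by (rule tendsto_cong[THEN iffD1, rotated])
      (simp add: eventually_at_filter quotient)
  then show "\<exists>D. ((\<lambda>z. cinner (resolvent Z z x) y) has_field_derivative D) (at w within S)"
    unfolding has_field_derivative_iff by blast
qed


section \<open>Riesz projections\<close>

lemma Blinfun_scaleC_apply:
  "blinfun_apply (Blinfun (\<lambda>x. c *\<^sub>C x)) x = c *\<^sub>C (x :: 'a :: complex_hilbert_space)"
  by (simp add: bounded_linear_Blinfun_apply bounded_linear_scaleC)

lemma bounded_linear_complex_scaling:
  "bounded_linear (\<lambda>c. Blinfun (\<lambda>x :: 'a :: complex_hilbert_space. c *\<^sub>C x))"
proof (rule bounded_linear_intro[where K = 1])
  show "Blinfun (\<lambda>x :: 'a. (c + d) *\<^sub>C x) = Blinfun (\<lambda>x. c *\<^sub>C x) + Blinfun (\<lambda>x. d *\<^sub>C x)" for c d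
    by (rule blinfun_eqI)
      (simp only: blinfun.add_left Blinfun_scaleC_apply, simp only: scaleC_add_left)
  show "Blinfun (\<lambda>x :: 'a. (r *\<^sub>R c) *\<^sub>C x) = r *\<^sub>R Blinfun (\<lambda>x. c *\<^sub>C x)" for r c
    by (rule blinfun_eqI)
      (simp add: blinfun.scaleR_left Blinfun_scaleC_apply scaleR_eq_scaleC scaleC_scaleC
        scaleR_conv_of_real)
  show "norm (Blinfun (\<lambda>x :: 'a. c *\<^sub>C x)) \<le> norm c * 1" for c
    by (rule norm_blinfun_bound)
      (auto simp: Blinfun_scaleC_apply norm_scaleC)
qed

text \<open>All properties of the Riesz projection are read off from its matrix coefficients, which are
  contour integrals of scalar holomorphic functions. The integral of the definition has to be shown
  to exist in the operator norm, where the integrand is continuous.\<close>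

lemma cinner_op_contour_integral:
  fixes Z :: "'a :: complex_hilbert_space unbounded_op"
  assumes Z: "linear_op Z" and "0 < r" and sphere: "sphere z r \<subseteq> resolvent_set Z"
  shows "cinner (blinfun_apply (op_contour_integral (circlepath z r) (resolvent Z)) x) y =
    contour_integral (circlepath z r) (\<lambda>\<zeta>. cinner (resolvent Z \<zeta> x) y)"
proof -
  let ?\<gamma> = "circlepath z r"
  define v where "v t = 2 * pi * \<i> * r * exp (2 * of_real pi * \<i> * t)" for t :: real
  have v: "vector_derivative ?\<gamma> (at t within {0..1}) = v t" if "t \<in> {0..1}" for t
    using that by (simp add: vector_derivative_circlepath01 v_def)
  have \<gamma>: "?\<gamma> t \<in> resolvent_set Z" if "t \<in> {0..1}" for t
    using that sphere \<open>0 < r\<close> path_image_circlepath_nonneg[of r z] unfolding path_image_def by auto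
  define F where "F = (\<lambda>t. Blinfun (\<lambda>x. vector_derivative ?\<gamma> (at t within {0..1}) *\<^sub>C resolvent Z (?\<gamma> t) x))"
  have F_apply: "blinfun_apply (F t) x = v t *\<^sub>C resolvent Z (?\<gamma> t) x" if "t \<in> {0..1}" for t x
    unfolding F_def v[OF that]
    by (intro fun_cong[OF bounded_linear_Blinfun_apply]
        bounded_linear_compose[OF bounded_linear_scaleC bounded_linear_resolvent[OF \<gamma>[OF that]]])
  have "F t = Blinfun (\<lambda>x. v t *\<^sub>C x) o\<^sub>L Blinfun (resolvent Z (?\<gamma> t))" if "t \<in> {0..1}" for t
    by (rule blinfun_eqI)
      (simp add: F_apply[OF that] bounded_linear_Blinfun_apply bounded_linear_scaleC
        bounded_linear_resolvent[OF \<gamma>[OF that]])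
  moreover have "continuous_on {0..1} (\<lambda>t. Blinfun (\<lambda>x. v t *\<^sub>C x) o\<^sub>L Blinfun (resolvent Z (?\<gamma> t)))"
  proof (intro bounded_bilinear.continuous_on[OF bounded_bilinear_blinfun_compose])
    show "continuous_on {0..1} (\<lambda>t. Blinfun (\<lambda>x :: 'a. v t *\<^sub>C x))"
      by (intro bounded_linear.continuous_on[OF bounded_linear_complex_scaling])
        (auto simp: v_def intro!: continuous_intros)
    show "continuous_on {0..1} (\<lambda>t. Blinfun (resolvent Z (?\<gamma> t)))"
      by (rule continuous_on_compose2[OF continuous_resolvent_Blinfun[OF Z sphere]])
        (use \<open>0 < r\<close> path_image_circlepath_nonneg[of r z] in
          \<open>auto simp: path_image_def intro!: path_circlepath[unfolded path_def]\<close>)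
  qed
  ultimately have "continuous_on {0..1} F"
    by (metis (no_types, lifting) continuous_on_cong)
  then have "(F has_integral integral {0..1} F) {0..1}"
    by (intro integrable_integral integrable_continuous_real)
  then have "((\<lambda>B. cinner (blinfun_apply B x) y) \<circ> F has_integral
      cinner (blinfun_apply (integral {0..1} F) x) y) {0..1}"
    by (rule has_integral_linear) (rule bounded_linear_matrix_coefficient)
  then have "((\<lambda>\<zeta>. cinner (resolvent Z \<zeta> x) y) has_contour_integral
      cinner (blinfun_apply (integral {0..1} F) x) y) ?\<gamma>"
    unfolding has_contour_integral_def
    by (rule has_integral_eq[rotated]) (simp add: F_apply v cinner_scaleC_left mult.commute)
  then show ?thesis
    by (simp add: op_contour_integral_def F_def contour_integral_unique)
qed

lemma isolated_imp_cball:
  assumes "z isolated_in S"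
  shows "\<exists>r>0. cball z r \<inter> S = {z}"
proof -
  obtain e where "0 < e" and e: "\<forall>y\<in>S. dist z y < e \<longrightarrow> y = z" "z \<in> S"
    using assms unfolding isolated_in_dist_Ex_iff by blast
  then show ?thesis by (intro exI[of _ "e / 2"]) force
qed

lemma cinner_riesz_projection:
  assumes Z: "linear_op Z" and iso: "z isolated_in spectrum Z"
  obtains r where "0 < r" "cball z r \<inter> spectrum Z = {z}"
    "\<And>x y. 2 * pi * \<i> * cinner (riesz_projection Z z x) y =
      contour_integral (circlepath z r) (\<lambda>\<zeta>. cinner (resolvent Z \<zeta> x) y)"
proof -
  define r where "r = (SOME r. r > 0 \<and> cball z r \<inter> spectrum Z = {z})"
  have r: "r > 0 \<and> cball z r \<inter> spectrum Z = {z}"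
    unfolding r_def by (rule someI_ex) (rule isolated_imp_cball[OF iso])
  have "sphere z r \<subseteq> resolvent_set Z"
  proof
    fix w assume w: "w \<in> sphere z r"
    then have "w \<noteq> z" using r by auto
    then have "w \<notin> spectrum Z" using w r by (auto simp: set_eq_iff)
    then show "w \<in> resolvent_set Z" by (simp add: spectrum_def)
  qed
  then have "2 * pi * \<i> * cinner (riesz_projection Z z x) y =
      contour_integral (circlepath z r) (\<lambda>\<zeta>. cinner (resolvent Z \<zeta> x) y)" for x y
    using cinner_op_contour_integral[OF Z, of r z x y] r
    by (simp add: riesz_projection_def Let_def r_def[symmetric] cinner_scaleC_left)
  then show ?thesis using r that by blast
qed

context
  fixes Z :: "'a :: complex_hilbert_space unbounded_op" and z :: complex and r :: real
    and P :: "'a \<Rightarrow> 'a"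
  assumes Z: "linear_op Z" and r: "0 < r" and cball: "cball z r \<inter> spectrum Z = {z}"
    and P: "\<And>x y. 2 * pi * \<i> * cinner (P x) y =
      contour_integral (circlepath z r) (\<lambda>\<zeta>. cinner (resolvent Z \<zeta> x) y)"
begin

private lemma punctured: "w \<in> cball z r \<Longrightarrow> w \<noteq> z \<Longrightarrow> w \<in> resolvent_set Z"
  using cball unfolding spectrum_def by (metis ComplI IntI singletonD)

private lemma circle: "w \<in> path_image (circlepath z r) \<Longrightarrow> w \<in> resolvent_set Z"
  using r by (intro punctured) auto

private lemma integrable:
  "(\<lambda>\<zeta>. cinner (resolvent Z \<zeta> x) y) contour_integrable_on circlepath z r"
  using circle by (intro contour_integrable_continuous_circlepath continuous_resolvent_cinner[OF Z]) auto

lemma clinear_riesz: "clinear P"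
proof (rule clinearI; rule vector_eq_by_cinner)
  have lin: "clinear (resolvent Z w)" if "w \<in> path_image (circlepath z r)" for w
    by (rule clinear_resolvent[OF Z circle[OF that]])
  fix x y u c
  have "2 * pi * \<i> * cinner (P (x + y)) u = contour_integral (circlepath z r)
      (\<lambda>\<zeta>. cinner (resolvent Z \<zeta> x) u + cinner (resolvent Z \<zeta> y) u)"
    unfolding P by (rule contour_integral_eq) (simp add: clinear_add[OF lin] cinner_add_left)
  also have "\<dots> = 2 * pi * \<i> * cinner (P x) u + 2 * pi * \<i> * cinner (P y) u"
    unfolding P by (rule contour_integral_add[OF integrable integrable])
  also have "\<dots> = 2 * pi * \<i> * cinner (P x + P y) u"
    by (simp add: cinner_add_left distrib_left)
  finally show "cinner (P (x + y)) u = cinner (P x + P y) u" by simp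
  have "2 * pi * \<i> * cinner (P (c *\<^sub>C x)) u = contour_integral (circlepath z r)
      (\<lambda>\<zeta>. c * cinner (resolvent Z \<zeta> x) u)"
    unfolding P by (rule contour_integral_eq) (simp add: clinear_scale[OF lin] cinner_scaleC_left)
  also have "\<dots> = c * (2 * pi * \<i> * cinner (P x) u)"
    unfolding P by (rule contour_integral_lmul[OF integrable])
  finally show "cinner (P (c *\<^sub>C x)) u = cinner (c *\<^sub>C P x) u"
    by (simp add: cinner_scaleC_left)
qed

lemma riesz_commute_resolvent:
  assumes a: "a \<in> resolvent_set Z"
  shows "P (resolvent Z a x) = resolvent Z a (P x)"
proof (rule vector_eq_by_cinner)
  fix y
  note adj = cinner_bounded_adjoint[OF bounded_linear_resolvent[OF a] clinear_resolvent[OF Z a]]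
  have "2 * pi * \<i> * cinner (P (resolvent Z a x)) y = contour_integral (circlepath z r)
      (\<lambda>\<zeta>. cinner (resolvent Z \<zeta> x) (bounded_adjoint (resolvent Z a) y))"
    unfolding P
    by (rule contour_integral_eq) (simp add: resolvent_commute[OF Z circle a] adj[symmetric])
  also have "\<dots> = 2 * pi * \<i> * cinner (resolvent Z a (P x)) y"
    unfolding P[symmetric] by (simp add: adj)
  finally show "cinner (P (resolvent Z a x)) y = cinner (resolvent Z a (P x)) y" by simp
qed

text \<open>With a second circle of half the radius, \<open>R\<^sub>\<zeta> R\<^sub>\<xi> = (R\<^sub>\<xi> - R\<^sub>\<zeta>) / (\<zeta> - \<xi>)\<close> for \<open>\<zeta>\<close> on the outer and
  \<open>\<xi>\<close> on the inner circle. The term with \<open>R\<^sub>\<zeta>\<close> integrates to zero over \<open>\<xi>\<close>, and in the other one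
  the \<open>\<zeta>\<close>-integral of \<open>1 / (\<zeta> - \<xi>)\<close> is \<open>2 \<pi> i\<close>.\<close>

lemma riesz_idempotent: "P (P x) = P x"
proof (rule vector_eq_by_cinner)
  fix y
  define C where "C = circlepath z r"
  define D where "D = circlepath z (r / 2)"
  define c where "c = 2 * pi * \<i>"
  have "c \<noteq> 0" by (simp add: c_def)
  define g where "g = (\<lambda>\<xi>. cinner (resolvent Z \<xi> x) y)"
  have D_punctured: "w \<in> resolvent_set Z" if "w \<in> path_image D" for w
    using that r by (intro punctured) (auto simp: D_def)
  have CD_neq: "\<zeta> \<noteq> \<xi>" if "\<zeta> \<in> path_image C" "\<xi> \<in> path_image D" for \<zeta> \<xi>
    using that r by (auto simp: C_def D_def)
  have open_set: "open (resolvent_set Z \<union> ball z r)"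
    by (intro open_Un open_resolvent_set[OF Z] open_ball)
  have shrink: "contour_integral C (\<lambda>\<xi>. cinner (resolvent Z \<xi> x) u) =
      contour_integral D (\<lambda>\<xi>. cinner (resolvent Z \<xi> x) u)" for u
    unfolding C_def D_def
  proof (rule contour_integral_circlepath_eq(3)[OF open_set])
    show "(\<lambda>\<xi>. cinner (resolvent Z \<xi> x) u) holomorphic_on resolvent_set Z \<union> ball z r - {z}"
      by (intro holomorphic_resolvent_cinner[OF Z]) (auto intro: punctured)
    show "cball z r \<subseteq> resolvent_set Z \<union> ball z r"
    proof
      fix w assume "w \<in> cball z r"
      then show "w \<in> resolvent_set Z \<union> ball z r"
        using punctured[of w] r by (cases "w = z") auto
    qed
  qed (use r in auto)
  have inner: "c * cinner (resolvent Z \<zeta> (P x)) y = contour_integral D (\<lambda>\<xi>. g \<xi> / (\<zeta> - \<xi>))"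
    if \<zeta>: "\<zeta> \<in> path_image C" for \<zeta>
  proof -
    have \<zeta>': "\<zeta> \<in> resolvent_set Z" using \<zeta> circle by (simp add: C_def)
    note adj = cinner_bounded_adjoint[OF bounded_linear_resolvent[OF \<zeta>'] clinear_resolvent[OF Z \<zeta>']]
    have "c * cinner (resolvent Z \<zeta> (P x)) y =
        contour_integral D (\<lambda>\<xi>. cinner (resolvent Z \<xi> x) (bounded_adjoint (resolvent Z \<zeta>) y))"
      unfolding adj c_def P C_def[symmetric] by (rule shrink)
    also have "\<dots> = contour_integral D (\<lambda>\<xi>. g \<xi> / (\<zeta> - \<xi>) - g \<zeta> * (1 / (\<zeta> - \<xi>)))"
    proof (rule contour_integral_eq)
      fix \<xi> assume \<xi>: "\<xi> \<in> path_image D"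
      have "g \<xi> - g \<zeta> = (\<zeta> - \<xi>) * cinner (resolvent Z \<xi> x) (bounded_adjoint (resolvent Z \<zeta>) y)"
        using resolvent_identity[OF Z \<zeta>' D_punctured[OF \<xi>], of x] unfolding g_def adj[symmetric]
        by (metis cinner_diff_left cinner_scaleC_left)
      then show "cinner (resolvent Z \<xi> x) (bounded_adjoint (resolvent Z \<zeta>) y) =
          g \<xi> / (\<zeta> - \<xi>) - g \<zeta> * (1 / (\<zeta> - \<xi>))"
        using CD_neq[OF \<zeta> \<xi>] by (simp flip: diff_divide_distrib)
    qed
    also have "\<dots> = contour_integral D (\<lambda>\<xi>. g \<xi> / (\<zeta> - \<xi>)) - 0"
    proof -
      have "continuous_on (path_image D) (\<lambda>\<xi>. g \<xi> / (\<zeta> - \<xi>))"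
        using CD_neq[OF \<zeta>] D_punctured unfolding g_def
        by (intro continuous_intros continuous_resolvent_cinner[OF Z]) auto
      then have int: "(\<lambda>\<xi>. g \<xi> / (\<zeta> - \<xi>)) contour_integrable_on D"
        unfolding D_def by (rule contour_integrable_continuous_circlepath)
      have zero: "((\<lambda>\<xi>. g \<zeta> * (1 / (\<zeta> - \<xi>))) has_contour_integral 0) D"
      proof (rule Cauchy_theorem_disc_simple[of _ z r])
        show "(\<lambda>\<xi>. g \<zeta> * (1 / (\<zeta> - \<xi>))) holomorphic_on ball z r"
          using \<zeta> r by (intro holomorphic_intros) (auto simp: C_def)
      qed (use r in \<open>auto simp: D_def\<close>)
      show ?thesis
        unfolding contour_integral_diff[OF int has_contour_integral_integrable[OF zero]]
          contour_integral_unique[OF zero] ..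
    qed
    finally show ?thesis by simp
  qed
  have outer: "contour_integral C (\<lambda>\<zeta>. g \<xi> / (\<zeta> - \<xi>)) = c * g \<xi>" if \<xi>: "\<xi> \<in> path_image D" for \<xi>
  proof -
    have "cmod (\<xi> - z) < r" using \<xi> r by (auto simp: D_def dist_norm norm_minus_commute)
    then have "((\<lambda>\<zeta>. g \<xi> / (\<zeta> - \<xi>)) has_contour_integral 2 * of_real pi * \<i> * g \<xi>) C"
      unfolding C_def by (intro Cauchy_integral_circlepath_simple) auto
    then show ?thesis by (simp add: contour_integral_unique c_def)
  qed
  have "c * (c * cinner (P (P x)) y) = c * contour_integral C (\<lambda>\<zeta>. cinner (resolvent Z \<zeta> (P x)) y)"
    unfolding C_def c_def P ..
  also have "\<dots> = contour_integral C (\<lambda>\<zeta>. c * cinner (resolvent Z \<zeta> (P x)) y)"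
    unfolding C_def by (rule contour_integral_lmul[OF integrable, symmetric])
  also have "\<dots> = contour_integral C (\<lambda>\<zeta>. contour_integral D (\<lambda>\<xi>. g \<xi> / (\<zeta> - \<xi>)))"
    by (rule contour_integral_eq) (rule inner)
  also have "\<dots> = contour_integral D (\<lambda>\<xi>. contour_integral C (\<lambda>\<zeta>. g \<xi> / (\<zeta> - \<xi>)))"
  proof (rule contour_integral_swap)
    have "continuous_on (path_image D) g"
      unfolding g_def using D_punctured by (intro continuous_resolvent_cinner[OF Z]) auto
    then have "continuous_on (path_image C \<times> path_image D) (\<lambda>p. g (snd p) / (fst p - snd p))"
      using CD_neq
      by (intro continuous_intros continuous_on_compose2[of "path_image D" g _ snd]) auto
    then show "continuous_on (path_image C \<times> path_image D) (\<lambda>(\<zeta>, \<xi>). g \<xi> / (\<zeta> - \<xi>))"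
      by (simp add: case_prod_unfold)
    show "continuous_on {0..1} (\<lambda>t. vector_derivative C (at t))"
      "continuous_on {0..1} (\<lambda>t. vector_derivative D (at t))"
      unfolding C_def D_def by (auto simp: vector_derivative_circlepath intro!: continuous_intros)
  qed (auto simp: C_def D_def)
  also have "\<dots> = contour_integral D (\<lambda>\<xi>. c * g \<xi>)"
    by (rule contour_integral_eq) (rule outer)
  also have "\<dots> = c * contour_integral D g"
  proof (rule contour_integral_lmul)
    show "g contour_integrable_on D"
      unfolding D_def g_def using D_punctured unfolding D_def
      by (intro contour_integrable_continuous_circlepath continuous_resolvent_cinner[OF Z]) auto
  qed
  also have "contour_integral D g = c * cinner (P x) y"
    unfolding c_def P g_def shrink[symmetric] C_def ..
  finally show "cinner (P (P x)) y = cinner (P x) y" using \<open>c \<noteq> 0\<close> by simp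
qed

text \<open>An eigenvector of \<open>R\<^sub>a\<close> for \<open>\<kappa>\<close> is an eigenvector of \<open>Z\<close> for \<open>\<nu> = a - 1/\<kappa>\<close>, and \<open>P\<close> multiplies
  it by \<open>1/(2\<pi>i)\<close> times the integral of \<open>1/(\<zeta> - \<nu>)\<close>, which vanishes if \<open>\<nu>\<close> is outside the circle.\<close>

lemma riesz_range_eigenvalue:
  assumes a: "a \<in> resolvent_set Z" and w: "P w = w" "w \<noteq> 0" and eig: "resolvent Z a w = \<kappa> *\<^sub>C w"
  shows "\<kappa> = 1 / (a - z)"
proof -
  have sub: "csubspace (op_dom Z)"
    and scale: "\<And>c x. x \<in> op_dom Z \<Longrightarrow> op_fun Z (c *\<^sub>C x) = c *\<^sub>C op_fun Z x"
    using Z by (auto simp: linear_op_def)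
  have "op_fun Z 0 = 0"
    using scale[of 0 0] complex_vector.subspace_0[OF sub] by simp
  then have "\<kappa> \<noteq> 0"
    using resolvent_right_inverse[OF a, of w] eig w(2) by auto
  define \<nu> where "\<nu> = a - 1 / \<kappa>"
  have "w = (1 / \<kappa>) *\<^sub>C resolvent Z a w"
    using \<open>\<kappa> \<noteq> 0\<close> by (simp add: eig scaleC_scaleC scaleC_one)
  then have dom: "w \<in> op_dom Z"
    using complex_vector.subspace_scale[OF sub resolvent_dom[OF a]] by metis
  have "\<kappa> *\<^sub>C (a *\<^sub>C w - op_fun Z w) = w"
    using resolvent_right_inverse[OF a, of w]
    by (simp add: eig scale[OF dom] complex_vector.scale_right_diff_distrib scaleC_scaleC mult.commute)
  then have "(1 / \<kappa>) *\<^sub>C \<kappa> *\<^sub>C (a *\<^sub>C w - op_fun Z w) = (1 / \<kappa>) *\<^sub>C w" by simp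
  then have Zw: "op_fun Z w = \<nu> *\<^sub>C w"
    using \<open>\<kappa> \<noteq> 0\<close>
    by (simp add: scaleC_scaleC scaleC_one \<nu>_def complex_vector.scale_left_diff_distrib algebra_simps)
  have R: "(\<zeta> - \<nu>) *\<^sub>C resolvent Z \<zeta> w = w" if \<zeta>: "\<zeta> \<in> resolvent_set Z" for \<zeta>
    using resolvent_left_inverse[OF \<zeta> dom] clinear_scale[OF clinear_resolvent[OF Z \<zeta>]]
    by (simp add: Zw flip: complex_vector.scale_left_diff_distrib)
  have spec: "\<nu> \<in> spectrum Z"
    using R[of \<nu>] w(2) by (auto simp: spectrum_def)
  have "\<nu> = z"
  proof (rule ccontr)
    assume "\<nu> \<noteq> z"
    then have "\<nu> \<notin> cball z r" using spec cball by (metis IntI singletonD)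
    then have out: "r < dist z \<nu>" by simp
    have "contour_integral (circlepath z r) (\<lambda>\<zeta>. cinner (resolvent Z \<zeta> w) w) =
        contour_integral (circlepath z r) (\<lambda>\<zeta>. cinner w w / (\<zeta> - \<nu>))"
    proof (rule contour_integral_eq)
      fix \<zeta> assume \<zeta>: "\<zeta> \<in> path_image (circlepath z r)"
      then have "\<zeta> \<noteq> \<nu>" using out r by auto
      moreover have "cinner w w = (\<zeta> - \<nu>) * cinner (resolvent Z \<zeta> w) w"
        using R[OF circle[OF \<zeta>]] by (metis cinner_scaleC_left)
      ultimately show "cinner (resolvent Z \<zeta> w) w = cinner w w / (\<zeta> - \<nu>)"
        by (simp add: field_simps)
    qed
    also have "\<dots> = 0"
    proof (rule contour_integral_unique, rule Cauchy_theorem_disc_simple[of _ z "dist z \<nu>"])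
      show "(\<lambda>\<zeta>. cinner w w / (\<zeta> - \<nu>)) holomorphic_on ball z (dist z \<nu>)"
        by (intro holomorphic_intros) auto
    qed (use r out in auto)
    finally show False using P[of w w] w by (simp add: cinner_self)
  qed
  then have "a - z = 1 / \<kappa>" by (auto simp: \<nu>_def)
  then show ?thesis by simp
qed

end


section \<open>The numerical range of the resolvent of a nonnegative operator\<close>

lemma selfadjoint_symmetric:
  assumes "selfadjoint_op Z" "x \<in> op_dom Z" "y \<in> op_dom Z"
  shows "cinner (op_fun Z x) y = cinner x (op_fun Z y)"
proof -
  have dense: "closure (op_dom Z) = UNIV" and graph: "op_graph (adjoint_op Z) = op_graph Z"
    using assms(1) by (auto simp: selfadjoint_op_def)
  have "(y, op_fun Z y) \<in> op_graph (adjoint_op Z)"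
    using assms(3) by (simp add: graph) (auto simp: op_graph_def)
  then have y: "y \<in> op_dom (adjoint_op Z)" "op_fun Z y = op_fun (adjoint_op Z) y"
    by (auto simp: op_graph_def)
  then obtain z where z: "\<forall>x\<in>op_dom Z. cinner (op_fun Z x) y = cinner x z"
    by (auto simp: adjoint_op_def)
  \<comment> \<open>Density of the domain makes the vector in the definition of the adjoint unique.\<close>
  have "(THE z. \<forall>x\<in>op_dom Z. cinner (op_fun Z x) y = cinner x z) = z"
  proof (rule the_equality)
    show "\<forall>x\<in>op_dom Z. cinner (op_fun Z x) y = cinner x z" by (rule z)
    fix w assume w: "\<forall>x\<in>op_dom Z. cinner (op_fun Z x) y = cinner x w"
    have "closed {x. cinner x (w - z) = 0}"
      by (intro closed_Collect_eq continuous_on_const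
          bounded_linear.continuous_on[OF bounded_linear_cinner_left continuous_on_id])
    moreover have "op_dom Z \<subseteq> {x. cinner x (w - z) = 0}"
      using z w by (simp add: subset_iff cinner_diff_right)
    ultimately have "closure (op_dom Z) \<subseteq> {x. cinner x (w - z) = 0}"
      by (rule closure_minimal[rotated])
    then have "cinner (w - z) (w - z) = 0" using dense by blast
    then show "w = z" by (simp add: cinner_self)
  qed
  then have "op_fun Z y = z" using y(2) by (simp add: adjoint_op_def)
  then show ?thesis using z assms(2) by blast
qed

lemma selfadjoint_resolvent_symmetric:
  assumes "selfadjoint_op Z" "complex_of_real a \<in> resolvent_set Z"
  shows "cinner (resolvent Z a x) y = cinner x (resolvent Z a y)"
proof -
  let ?u = "resolvent Z a x" and ?v = "resolvent Z a y"
  note dom = resolvent_dom[OF assms(2)] and inv = resolvent_right_inverse[OF assms(2)]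
  have "cinner ?u y = cinner ?u (a *\<^sub>C ?v - op_fun Z ?v)" by (simp only: inv)
  also have "\<dots> = cinner (a *\<^sub>C ?u - op_fun Z ?u) ?v"
    by (simp add: cinner_diff_left cinner_diff_right cinner_scaleC_left cinner_scaleC_right
        selfadjoint_symmetric[OF assms(1) dom dom])
  also have "\<dots> = cinner x ?v" by (simp only: inv)
  finally show ?thesis .
qed

text \<open>Positivity of the form at \<open>x - T x / M\<close> gives \<open>\<parallel>T x\<parallel>\<^sup>2 \<le> M \<langle>T x, x\<rangle>\<close>.\<close>

lemma norm_sq_le_positive_form:
  fixes T :: "'a :: complex_hilbert_space \<Rightarrow> 'a"
  assumes T: "clinear T" and sym: "\<And>x y. cinner (T x) y = cinner x (T y)"
    and pos: "\<And>x. 0 \<le> Re (cinner (T x) x)" and "0 < M" and M: "\<And>x. norm (T x) \<le> norm x * M"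
  shows "(norm (T x))\<^sup>2 \<le> M * Re (cinner (T x) x)"
proof -
  define u where "u = complex_of_real (1 / M) *\<^sub>C T x"
  have "cinner (T u) x = complex_of_real (1 / M) * complex_of_real ((norm (T x))\<^sup>2)"
    by (simp add: u_def clinear_scale[OF T] cinner_scaleC_left sym cinner_self)
  then have 1: "Re (cinner (T u) x) = (norm (T x))\<^sup>2 / M"
    by (simp flip: of_real_mult of_real_power)
  have 2: "Re (cinner (T x) u) = (norm (T x))\<^sup>2 / M"
    using 1 Re_cinner_commute[of "T x" u] sym[of u x] by simp
  have "Re (cinner (T u) u) \<le> norm (T u) * norm u"
    using cauchy_schwarz[of "T u" u] complex_Re_le_cmod[of "cinner (T u) u"] by linarith
  also have "\<dots> \<le> (norm u * M) * norm u" using M[of u] by (rule mult_right_mono) simp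
  also have "\<dots> = (norm (T x))\<^sup>2 / M"
    using \<open>0 < M\<close> by (simp add: u_def norm_scaleC norm_divide power2_eq_square)
  finally have "Re (cinner (T (x - u)) (x - u)) \<le> Re (cinner (T x) x) - (norm (T x))\<^sup>2 / M"
    using 1 2 by (simp add: clinear_diff[OF T] cinner_diff_left cinner_diff_right)
  then have "(norm (T x))\<^sup>2 / M \<le> Re (cinner (T x) x)"
    using pos[of "x - u"] by linarith
  then show ?thesis using \<open>0 < M\<close> by (simp add: field_simps)
qed

lemma numerical_range_bdd_below:
  assumes "bounded_linear A"
  shows "bdd_below {Re (cinner (A x) x) |x :: 'a :: complex_hilbert_space. norm x = 1}"
proof -
  obtain B where B: "\<And>x. norm (A x) \<le> norm x * B"
    using bounded_linear.bounded[OF assms] by blast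
  show ?thesis
  proof (rule bdd_belowI)
    fix t assume "t \<in> {Re (cinner (A x) x) |x :: 'a. norm x = 1}"
    then obtain x where x: "t = Re (cinner (A x) x)" "norm x = 1" by blast
    have "\<bar>t\<bar> \<le> norm (A x) * norm x"
      unfolding x(1) by (rule order_trans[OF abs_Re_le_cmod cauchy_schwarz])
    then show "- B \<le> t" using B[of x] x(2) by simp
  qed
qed

text \<open>As \<open>m\<close> is the exact lower bound, the form of \<open>A - m\<close> is nonnegative and
  \<open>\<parallel>(A - m) x\<parallel>\<^sup>2 \<le> C \<langle>(A - m) x, x\<rangle>\<close> gets arbitrarily small on unit vectors, contrary to the gap.\<close>

lemma infimum_numerical_range_not_bounded_below:
  fixes A :: "'a :: complex_hilbert_space \<Rightarrow> 'a"
  assumes A: "clinear A" "bounded_linear A" and sym: "\<And>x y. cinner (A x) y = cinner x (A y)"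
    and m: "m = Inf {Re (cinner (A x) x) |x. norm x = 1}" and "norm (x\<^sub>0 :: 'a) = 1"
    and "0 < \<delta>" and gap: "\<And>x. \<delta> * norm x \<le> norm (A x - complex_of_real m *\<^sub>C x)"
  shows False
proof -
  let ?X = "{Re (cinner (A x) x) |x. norm x = 1}"
  obtain B where "0 < B" and B: "\<And>x. norm (A x) \<le> norm x * B"
    using bounded_linear.pos_bounded[OF A(2)] by blast
  have "Re (cinner (A x\<^sub>0) x\<^sub>0) \<in> ?X"
    using \<open>norm x\<^sub>0 = 1\<close> by (intro CollectI exI[of _ x\<^sub>0] conjI refl)
  then have X: "?X \<noteq> {}" by (metis empty_iff)
  note bdd = numerical_range_bdd_below[OF A(2)]
  define T where "T x = A x - complex_of_real m *\<^sub>C x" for x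
  have T: "clinear T" unfolding T_def by (rule clinear_shift[OF A(1)])
  have form: "Re (cinner (T x) x) = Re (cinner (A x) x) - m * (norm x)\<^sup>2" for x
    by (simp add: T_def cinner_diff_left cinner_scaleC_left cinner_self flip: of_real_power of_real_mult)
  have pos: "0 \<le> Re (cinner (T x) x)" for x
  proof (cases "x = 0")
    case False
    define u where "u = complex_of_real (1 / norm x) *\<^sub>C x"
    have u: "norm u = 1" using False by (simp add: u_def norm_scaleC norm_divide)
    have "m \<le> Re (cinner (A u) u)" unfolding m by (rule cInf_lower[OF _ bdd]) (use u in blast)
    then have "0 \<le> Re (cinner (T u) u)" by (simp add: form u)
    moreover have "x = complex_of_real (norm x) *\<^sub>C u"
      using False by (simp add: u_def scaleC_scaleC scaleC_one)
    then have "cinner (T x) x = complex_of_real ((norm x)\<^sup>2) * cinner (T u) u"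
      by (metis (no_types, lifting) T cinner_scaleC_left cinner_scaleC_right clinear_scale
          complex_cnj_complex_of_real mult.assoc of_real_mult power2_eq_square)
    ultimately show ?thesis by simp
  qed (simp add: clinear_zero[OF T])
  have T_sym: "cinner (T x) y = cinner x (T y)" for x y
    by (simp add: T_def cinner_diff_left cinner_diff_right cinner_scaleC_left cinner_scaleC_right sym)
  define C where "C = B + \<bar>m\<bar>"
  have "0 < C" using \<open>0 < B\<close> by (simp add: C_def)
  have T_le: "norm (T x) \<le> norm x * C" for x
    using norm_triangle_ineq4[of "A x" "complex_of_real m *\<^sub>C x"] B[of x]
    by (simp add: T_def C_def norm_scaleC algebra_simps)
  have "m + \<delta>\<^sup>2 / C \<le> Inf ?X"
  proof (rule cInf_greatest[OF X])
    fix t assume "t \<in> ?X"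
    then obtain x where x: "t = Re (cinner (A x) x)" "norm x = 1" by blast
    have "\<delta>\<^sup>2 \<le> (norm (T x))\<^sup>2"
      using gap[of x] x(2) \<open>0 < \<delta>\<close> by (intro power_mono) (auto simp: T_def)
    also have "\<dots> \<le> C * Re (cinner (T x) x)"
      by (rule norm_sq_le_positive_form[OF T T_sym pos \<open>0 < C\<close> T_le])
    finally show "m + \<delta>\<^sup>2 / C \<le> t"
      using \<open>0 < C\<close> x(2) by (simp add: form x(1) field_simps)
  qed
  moreover have "0 < \<delta>\<^sup>2 / C" using \<open>0 < \<delta>\<close> \<open>0 < C\<close> by simp
  ultimately show False using m by linarith
qed

text \<open>\<open>R\<^sub>a - m\<close> equals \<open>-m (\<nu> - Z) R\<^sub>a\<close> with \<open>\<nu> = a - 1/m\<close>, so it is bounded below if \<open>\<nu>\<close> is in the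
  resolvent set.\<close>

lemma resolvent_bounded_below:
  assumes Z: "linear_op Z" and a: "a \<in> resolvent_set Z" and "m \<noteq> 0"
    and \<nu>: "a - 1 / m \<in> resolvent_set Z"
  shows "\<exists>\<delta>>0. \<forall>x. \<delta> * norm x \<le> norm (resolvent Z a x - m *\<^sub>C x)"
proof -
  obtain M where "0 < M" and M: "\<And>x. norm (resolvent Z (a - 1 / m) x) \<le> norm x * M"
    using resolvent_norm_bound[OF Z \<nu>] by blast
  note lin = clinear_resolvent[OF Z \<nu>]
  define C where "C = 1 + M / cmod m"
  have "0 < C" using \<open>0 < M\<close> by (simp add: C_def add_pos_nonneg)
  have "cmod m * norm x \<le> C * norm (resolvent Z a x - m *\<^sub>C x)" for x
  proof -
    let ?u = "resolvent Z a x" and ?d = "resolvent Z a x - m *\<^sub>C x"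
    have "(a - 1 / m) *\<^sub>C ?u - op_fun Z ?u = x - (1 / m) *\<^sub>C ?u"
      using resolvent_right_inverse[OF a, of x]
      by (simp add: complex_vector.scale_left_diff_distrib algebra_simps)
    also have "\<dots> = (- 1 / m) *\<^sub>C ?d"
      using \<open>m \<noteq> 0\<close> by (simp add: complex_vector.scale_right_diff_distrib scaleC_scaleC scaleC_one)
    finally have "?u = resolvent Z (a - 1 / m) ((- 1 / m) *\<^sub>C ?d)"
      by (intro resolvent_eqI[OF \<nu> resolvent_dom[OF a], symmetric])
    then have "norm ?u \<le> norm ((- 1 / m) *\<^sub>C ?d) * M" using M by metis
    then have "norm ?u \<le> M / cmod m * norm ?d"
      by (simp add: norm_scaleC norm_divide mult.commute)
    moreover have "norm (m *\<^sub>C x) \<le> norm ?d + norm ?u"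
      using norm_triangle_ineq4[of ?u ?d] by simp
    ultimately show ?thesis by (simp add: C_def norm_scaleC algebra_simps)
  qed
  then have "\<forall>x. cmod m / C * norm x \<le> norm (resolvent Z a x - m *\<^sub>C x)"
    using \<open>0 < C\<close> by (simp add: divide_le_eq mult.commute)
  moreover have "0 < cmod m / C" using \<open>m \<noteq> 0\<close> \<open>0 < C\<close> by simp
  ultimately show ?thesis by blast
qed

text \<open>A real number \<open>m\<close> outside \<open>[1/a, 0]\<close> corresponds to \<open>\<nu> = a - 1/m < 0\<close>, which is in the resolvent
  set. So the exact bounds of the numerical range of \<open>R\<^sub>a\<close> and of \<open>- R\<^sub>a\<close> lie in the expected
  intervals.\<close>

lemma resolvent_numerical_range:
  assumes Z: "selfadjoint_op Z" and spec: "spectrum Z \<subseteq> complex_of_real ` {0..}" and "a < 0"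
    and "norm x = 1"
  shows "\<exists>t\<in>{1 / a..0}. cinner (resolvent Z (complex_of_real a) x) x = complex_of_real t"
proof -
  have lin: "linear_op Z" using Z by (simp add: selfadjoint_op_def)
  have \<rho>: "complex_of_real t \<in> resolvent_set Z" if "t < 0" for t
    using spec that by (force simp: spectrum_def)
  define A where "A = resolvent Z (complex_of_real a)"
  have A: "clinear A" "bounded_linear A" and sym: "cinner (A x) y = cinner x (A y)" for x y
    unfolding A_def using clinear_resolvent[OF lin] bounded_linear_resolvent
      selfadjoint_resolvent_symmetric[OF Z] \<rho>[OF \<open>a < 0\<close>] by auto
  have gap: "\<exists>\<delta>>0. \<forall>x. \<delta> * norm x \<le> norm (A x - complex_of_real m *\<^sub>C x)"
    if "m \<noteq> 0" "a - 1 / m < 0" for m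
    using resolvent_bounded_below[OF lin \<rho>[OF \<open>a < 0\<close>], of "complex_of_real m"] \<rho>[OF that(2)] that(1)
    unfolding A_def by simp
  have lower: "1 / a \<le> Re (cinner (A x) x)"
  proof (rule ccontr)
    define m where "m = Inf {Re (cinner (A x) x) |x. norm x = 1}"
    assume "\<not> 1 / a \<le> Re (cinner (A x) x)"
    moreover have "m \<le> Re (cinner (A x) x)"
      unfolding m_def by (rule cInf_lower[OF _ numerical_range_bdd_below[OF A(2)]]) (use \<open>norm x = 1\<close> in blast)
    ultimately have m: "m < 1 / a" by simp
    then have "m < 0" using \<open>a < 0\<close> by (meson divide_pos_neg less_trans zero_less_one)
    moreover have "a - 1 / m < 0"
      using m \<open>m < 0\<close> \<open>a < 0\<close> by (simp add: field_simps)
    ultimately obtain \<delta> where "0 < \<delta>" "\<And>x. \<delta> * norm x \<le> norm (A x - complex_of_real m *\<^sub>C x)"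
      using gap[of m] by blast
    then show False
      using infimum_numerical_range_not_bounded_below[OF A sym m_def \<open>norm x = 1\<close>] by blast
  qed
  have upper: "Re (cinner (A x) x) \<le> 0"
  proof (rule ccontr)
    define B where "B x = - A x" for x
    have B: "clinear B" "bounded_linear B" and B_sym: "cinner (B x) y = cinner x (B y)" for x y
    proof -
      show "clinear B"
        unfolding B_def using A(1) by (intro clinearI) (simp_all add: clinear_add clinear_scale)
      show "bounded_linear B" unfolding B_def using A(2) by (rule bounded_linear_minus)
      show "cinner (B x) y = cinner x (B y)" for x y
        by (simp add: B_def cinner_minus_left cinner_minus_right sym)
    qed
    define m where "m = Inf {Re (cinner (B x) x) |x. norm x = 1}"
    assume "\<not> Re (cinner (A x) x) \<le> 0"
    moreover have "m \<le> Re (cinner (B x) x)"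
      unfolding m_def by (rule cInf_lower[OF _ numerical_range_bdd_below[OF B(2)]]) (use \<open>norm x = 1\<close> in blast)
    ultimately have "m < 0" by (simp add: B_def cinner_minus_left)
    then have "a - 1 / (- m) < 0"
      using \<open>a < 0\<close> divide_pos_pos[of 1 "- m"] by (simp add: add_neg_neg)
    then obtain \<delta> where \<delta>: "0 < \<delta>" "\<And>x. \<delta> * norm x \<le> norm (A x - complex_of_real (- m) *\<^sub>C x)"
      using gap[of "- m"] \<open>m < 0\<close> by auto
    have "norm (B x - complex_of_real m *\<^sub>C x) = norm (A x - complex_of_real (- m) *\<^sub>C x)" for x
      using norm_minus_cancel[of "A x - complex_of_real (- m) *\<^sub>C x"]
      by (simp add: B_def)
    then show False
      using infimum_numerical_range_not_bounded_below[OF B B_sym m_def \<open>norm x = 1\<close> \<delta>(1)] \<delta>(2) by simp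
  qed
  have "cinner (A x) x = cnj (cinner (A x) x)"
    using sym[of x x] cinner_commute by metis
  then have "Im (cinner (A x) x) = 0"
    by (auto dest: arg_cong[where f = Im])
  then have "cinner (A x) x = complex_of_real (Re (cinner (A x) x))"
    by (simp add: complex_eq_iff)
  then show ?thesis
    using lower upper unfolding A_def by auto
qed


section \<open>The inequality for a single eigenvalue\<close>

text \<open>For \<open>t \<noteq> 0\<close> write \<open>t = 1/(a - s)\<close> with \<open>s \<ge> 0\<close>. Then the distance is \<open>\<bar>l - s\<bar> / (\<bar>l - a\<bar> (s + \<bar>a\<bar>))\<close>, and
  \<open>s + \<bar>a\<bar> = (s - \<bar>l\<bar>) + (\<bar>l\<bar> + \<bar>a\<bar>)\<close>, where \<open>s - \<bar>l\<bar>\<close> and \<open>d = dist(l, [0,\<infinity>))\<close> are both at most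
  \<open>\<bar>l - s\<bar>\<close> and \<open>d \<le> \<bar>l\<bar>\<close>.\<close>

lemma dist_resolvent_point_lower_bound:
  assumes "a < 0" and l: "l \<noteq> complex_of_real a" and t: "t \<in> {1 / a..0}"
  shows "infdist l (complex_of_real ` {0..}) / (cmod (l - a) * (cmod l + \<bar>a\<bar>))
    \<le> 2 * cmod (1 / (complex_of_real a - l) - complex_of_real t)"
proof -
  define d where "d = infdist l (complex_of_real ` {0..})"
  define q where "q = cmod l + \<bar>a\<bar>"
  have "0 < q" using \<open>a < 0\<close> norm_ge_zero[of l] unfolding q_def by linarith
  have la: "0 < cmod (l - a)" using l by simp
  have "0 \<le> d" by (simp add: d_def infdist_nonneg)
  have d_le: "d \<le> cmod (l - complex_of_real s)" if "0 \<le> s" for s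
    unfolding d_def using infdist_le[of "complex_of_real s" "complex_of_real ` {0..}" l] that
    by (simp add: dist_norm)
  have d_le_l: "d \<le> cmod l" using d_le[of 0] by simp
  have "d / q \<le> 2 * (cmod (l - a) * cmod (1 / (complex_of_real a - l) - complex_of_real t))"
  proof (cases "t = 0")
    case True
    have "d / q \<le> 1" using d_le_l \<open>0 < q\<close> by (simp add: q_def)
    then show ?thesis
      using True la by (simp add: norm_divide norm_minus_commute)
  next
    case False
    define s where "s = a - 1 / t"
    have "t < 0" using False t by simp
    then have "0 \<le> s"
      using t \<open>a < 0\<close> by (simp add: s_def field_simps)
    have sa: "0 < s + \<bar>a\<bar>" using \<open>0 \<le> s\<close> \<open>a < 0\<close> by linarith
    define e where "e = cmod (l - complex_of_real s)"
    have "t = 1 / (a - s)" using \<open>t < 0\<close> by (simp add: s_def)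
    then have "1 / (complex_of_real a - l) - complex_of_real t =
        1 / (complex_of_real a - l) - 1 / (complex_of_real a - complex_of_real s)" by simp
    also have "\<dots> = (l - complex_of_real s) / ((complex_of_real a - l) * complex_of_real (a - s))"
      using l sa \<open>a < 0\<close> by (simp add: diff_frac_eq)
    finally have "cmod (1 / (complex_of_real a - l) - complex_of_real t) = e / (cmod (l - a) * (s + \<bar>a\<bar>))"
      using \<open>a < 0\<close> \<open>0 \<le> s\<close> by (simp add: e_def norm_divide norm_mult norm_minus_commute[of l] del: of_real_diff)
    then have eq: "cmod (l - a) * cmod (1 / (complex_of_real a - l) - complex_of_real t) = e / (s + \<bar>a\<bar>)"
      using la by simp
    have "d \<le> e" using d_le[OF \<open>0 \<le> s\<close>] by (simp add: e_def)
    have "s - cmod l \<le> e"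
      using norm_triangle_ineq2[of "complex_of_real s" l] \<open>0 \<le> s\<close> by (simp add: e_def norm_minus_commute)
    then have "d * (s - cmod l) \<le> d * e" using \<open>0 \<le> d\<close> by (rule mult_left_mono)
    also have "\<dots> \<le> q * e"
      using d_le_l \<open>a < 0\<close> by (intro mult_right_mono) (auto simp: q_def e_def)
    finally have "d * (s - cmod l) + d * q \<le> q * e + e * q"
      using mult_right_mono[OF \<open>d \<le> e\<close>, of q] \<open>0 < q\<close> by linarith
    then have "d * (s + \<bar>a\<bar>) \<le> 2 * e * q" by (simp add: q_def algebra_simps)
    then show ?thesis
      unfolding eq using \<open>0 < q\<close> sa by (simp add: field_simps)
  qed
  then show ?thesis
    using la \<open>0 < q\<close> unfolding d_def[symmetric] q_def[symmetric] by (simp add: field_simps)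
qed


section \<open>Eigenvalue sums\<close>

text \<open>The Riesz projection commutes with the resolvent, so its range is invariant; being idempotent,
  it fixes its range, where the resolvent therefore has the single eigenvalue \<open>1 / (a - z)\<close>.\<close>

lemma riesz_range_generalized_eigenvectors:
  assumes Z: "linear_op Z" and a: "a \<in> resolvent_set Z" and z: "z \<in> discrete_spectrum Z"
  defines "V \<equiv> range (riesz_projection Z z)"
  shows "csubspace V" "\<exists>B. finite B \<and> V \<subseteq> cspan B"
    "v \<in> V \<Longrightarrow> \<exists>k. ((\<lambda>x. resolvent Z a x - (1 / (a - z)) *\<^sub>C x) ^^ k) v = 0"
proof -
  have iso: "z isolated_in spectrum Z" and fin: "\<exists>B. finite B \<and> V \<subseteq> cspan B"
    using z by (auto simp: discrete_spectrum_def V_def)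
  obtain r where r: "0 < r" "cball z r \<inter> spectrum Z = {z}"
    "\<And>x y. 2 * pi * \<i> * cinner (riesz_projection Z z x) y =
      contour_integral (circlepath z r) (\<lambda>\<zeta>. cinner (resolvent Z \<zeta> x) y)"
    by (rule cinner_riesz_projection[OF Z iso]) (rule that)
  have lin: "clinear (riesz_projection Z z)" by (rule clinear_riesz[OF Z r])
  have idem: "riesz_projection Z z (riesz_projection Z z x) = riesz_projection Z z x" for x
    by (rule riesz_idempotent[OF Z r])
  show V: "csubspace V"
    unfolding V_def complex_vector.subspace_def
  proof safe
    show "0 \<in> range (riesz_projection Z z)"
      using clinear_zero[OF lin] by (metis rangeI)
    fix x y c
    show "riesz_projection Z z x + riesz_projection Z z y \<in> range (riesz_projection Z z)"
      using clinear_add[OF lin] by (metis rangeI)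
    show "c *\<^sub>C riesz_projection Z z x \<in> range (riesz_projection Z z)"
      using clinear_scale[OF lin] by (metis rangeI)
  qed
  show "\<exists>B. finite B \<and> V \<subseteq> cspan B" by (rule fin)
  have inv: "resolvent Z a v \<in> V" if v: "v \<in> V" for v
  proof -
    obtain x where x: "v = riesz_projection Z z x" using v unfolding V_def by blast
    have "resolvent Z a v = riesz_projection Z z (resolvent Z a x)"
      unfolding x by (rule riesz_commute_resolvent[OF Z r a, symmetric])
    then show ?thesis by (simp add: V_def)
  qed
  have fixed: "riesz_projection Z z w = w" if "w \<in> V" for w
    using that idem by (auto simp: V_def)
  assume "v \<in> V"
  obtain B where B: "finite B" "V \<subseteq> cspan B" using fin by blast
  show "\<exists>k. ((\<lambda>x. resolvent Z a x - (1 / (a - z)) *\<^sub>C x) ^^ k) v = 0"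
  proof (rule single_eigenvalue_imp_generalized_eigenvectors[OF clinear_resolvent[OF Z a] V _ B])
    show "resolvent Z a u \<in> V" if "u \<in> V" for u using that by (rule inv)
    show "c = 1 / (a - z)" if "w \<in> V" "w \<noteq> 0" "resolvent Z a w = c *\<^sub>C w" for w c
      using riesz_range_eigenvalue[OF Z r a fixed[OF that(1)] that(2,3)] .
    show "v \<in> V" by fact
  qed
qed

text \<open>One triangular system is built whose span contains the ranges for all \<open>z \<in> F\<close>; its diagonal
  entries are then counted for each \<open>z\<close> separately.\<close>

lemma multiplicity_le_diagonal_count:
  assumes Z: "linear_op Z" and a: "a \<in> resolvent_set Z"
    and F: "finite F" "F \<subseteq> discrete_spectrum Z"
  obtains E where "orthonormal E" "finite E"
    "\<And>z. z \<in> F \<Longrightarrow> alg_multiplicity Z z \<le> card {e\<in>E. cinner (resolvent Z a e) e = 1 / (a - z)}"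
proof -
  define V where "V z = range (riesz_projection Z z)" for z
  note cl = clinear_resolvent[OF Z a]
  have V: "csubspace (V z)" "\<exists>B. finite B \<and> V z \<subseteq> cspan B"
    "\<And>v. v \<in> V z \<Longrightarrow> \<exists>k. ((\<lambda>x. resolvent Z a x - (1 / (a - z)) *\<^sub>C x) ^^ k) v = 0"
    if "z \<in> F" for z
    using riesz_range_generalized_eigenvectors[OF Z a, of z] that F(2) unfolding V_def by blast+
  have "\<exists>W. finite W \<and> W \<subseteq> V z \<and> V z \<subseteq> cspan W" if z: "z \<in> F" for z
  proof -
    obtain W where W: "W \<subseteq> V z" "\<not> complex_vector.dependent W" "V z \<subseteq> cspan W"
      using complex_vector.basis_exists[of "V z"] by metis
    obtain B where B: "finite B" "V z \<subseteq> cspan B" using V(2)[OF z] by blast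
    have "finite W"
      using complex_vector.independent_span_bound[OF B(1) W(2)] W(1) B(2) by blast
    then show ?thesis using W by blast
  qed
  then obtain W where W: "\<And>z. z \<in> F \<Longrightarrow> finite (W z)" "\<And>z. z \<in> F \<Longrightarrow> W z \<subseteq> V z"
    "\<And>z. z \<in> F \<Longrightarrow> V z \<subseteq> cspan (W z)" by metis
  have "\<exists>E. schur_system (resolvent Z a) E \<and> (\<Union>z\<in>F. W z) \<subseteq> cspan E"
  proof (rule schur_system_covering[OF cl])
    show "finite (\<Union>z\<in>F. W z)" using F(1) W(1) by blast
    fix b assume "b \<in> (\<Union>z\<in>F. W z)"
    then show "\<exists>\<mu> k. ((\<lambda>x. resolvent Z a x - \<mu> *\<^sub>C x) ^^ k) b = 0"
      using W(2) V(3) by blast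
  qed
  then obtain E where E: "schur_system (resolvent Z a) E" "(\<Union>z\<in>F. W z) \<subseteq> cspan E" by blast
  show ?thesis
  proof (rule that)
    show "orthonormal E" "finite E"
      using schur_system_orthonormal[OF E(1)] schur_system_finite[OF E(1)] .
    fix z assume z: "z \<in> F"
    have "cspan (W z) \<subseteq> cspan E"
      using E(2) z by (intro complex_vector.span_minimal complex_vector.subspace_span) blast
    then have "V z \<subseteq> cspan E" using W(3)[OF z] by blast
    then obtain X where "finite X" "V z \<subseteq> cspan X"
      "card X \<le> card {e\<in>E. cinner (resolvent Z a e) e = 1 / (a - z)}"
      using schur_system_count[OF cl E(1) V(1)[OF z] _ V(3)[OF z]] by blast
    then show "alg_multiplicity Z z \<le> card {e\<in>E. cinner (resolvent Z a e) e = 1 / (a - z)}"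
      unfolding alg_multiplicity_def V_def[symmetric]
      using complex_vector.dim_le_card order_trans by blast
  qed
qed

theorem theorem5p3p1:
  fixes H\<^sub>0 H :: "'a :: complex_hilbert_space unbounded_op"
    and a p :: real
  assumes "separable_space (euclidean :: 'a topology)"
    and "selfadjoint_op H\<^sub>0"
    and "spectrum H\<^sub>0 \<subseteq> complex_of_real ` {0..}"
    and "closed_op H"
    and "complex_of_real a \<in> resolvent_set H" and "a < 0"
    and "p \<ge> 1"
    and "(\<lambda>x. resolvent H (complex_of_real a) x - resolvent H\<^sub>0 (complex_of_real a) x)
           \<in> schatten_class p"
  shows "(\<lambda>z. real (alg_multiplicity H z) *
            (infdist z (complex_of_real ` {0..}) powr p /
              (cmod (z - complex_of_real a) powr p * (cmod z + \<bar>a\<bar>) powr p)))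
          summable_on discrete_spectrum H
        \<and> (\<Sum>\<^sub>\<infinity>z\<in>discrete_spectrum H. real (alg_multiplicity H z) *
            (infdist z (complex_of_real ` {0..}) powr p /
              (cmod (z - complex_of_real a) powr p * (cmod z + \<bar>a\<bar>) powr p)))
          \<le> 8 powr p * schatten_norm p
            (\<lambda>x. resolvent H (complex_of_real a) x - resolvent H\<^sub>0 (complex_of_real a) x) powr p"
proof -
  have H: "linear_op H" using assms(4) by (simp add: closed_op_def)
  note a = assms(5) and a_neg = assms(6) and p = assms(7)
  define K where "K = (\<lambda>x. resolvent H (complex_of_real a) x - resolvent H\<^sub>0 (complex_of_real a) x)"
  have K: "compact_op K" "summable (\<lambda>n. singular_value K n powr p)"
    using assms(8) unfolding K_def[symmetric] by (auto simp: schatten_class_def)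
  define S where "S = (\<Sum>n. singular_value K n powr p)"
  have "0 \<le> S" unfolding S_def by (rule suminf_nonneg[OF K(2)]) simp
  then have norm: "schatten_norm p K powr p = S"
    using p by (simp add: schatten_norm_def S_def[symmetric] powr_powr)
  define w where "w z = infdist z (complex_of_real ` {0..}) powr p /
      (cmod (z - complex_of_real a) powr p * (cmod z + \<bar>a\<bar>) powr p)" for z
  have w_nonneg: "0 \<le> w z" for z by (simp add: w_def)
  have neq: "z \<noteq> complex_of_real a" if "z \<in> discrete_spectrum H" for z
    using that a by (auto simp: discrete_spectrum_def isolated_in_def spectrum_def)
  have w_le: "w z \<le> 8 powr p * cmod (cinner (K e) e) powr p"
    if z: "z \<in> discrete_spectrum H" and e: "norm e = 1"
      "cinner (resolvent H (complex_of_real a) e) e = 1 / (complex_of_real a - z)" for z e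
  proof -
    obtain t where t: "t \<in> {1 / a..0}"
      "cinner (resolvent H\<^sub>0 (complex_of_real a) e) e = complex_of_real t"
      using resolvent_numerical_range[OF assms(2,3) a_neg e(1)] by blast
    have "infdist z (complex_of_real ` {0..}) / (cmod (z - complex_of_real a) * (cmod z + \<bar>a\<bar>)) \<le>
        2 * cmod (1 / (complex_of_real a - z) - complex_of_real t)"
      by (rule dist_resolvent_point_lower_bound[OF a_neg neq[OF z] t(1)])
    also have "\<dots> \<le> 8 * cmod (cinner (K e) e)"
      by (simp add: K_def cinner_diff_left e(2) t(2))
    finally have "(infdist z (complex_of_real ` {0..}) /
        (cmod (z - complex_of_real a) * (cmod z + \<bar>a\<bar>))) powr p \<le> (8 * cmod (cinner (K e) e)) powr p"
      using p by (intro powr_mono2) (auto simp: infdist_nonneg)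
    then show ?thesis
      by (simp add: w_def powr_divide powr_mult infdist_nonneg)
  qed
  have finite_bound: "(\<Sum>z\<in>F. real (alg_multiplicity H z) * w z) \<le> 8 powr p * S"
    if F: "finite F" "F \<subseteq> discrete_spectrum H" for F
  proof -
    obtain E where E: "orthonormal E" "finite E"
      and mult: "\<And>z. z \<in> F \<Longrightarrow> alg_multiplicity H z \<le>
        card {e\<in>E. cinner (resolvent H (complex_of_real a) e) e = 1 / (complex_of_real a - z)}"
      by (rule multiplicity_le_diagonal_count[OF H a F]) (rule that)
    define D where "D z = {e\<in>E. cinner (resolvent H (complex_of_real a) e) e = 1 / (complex_of_real a - z)}" for z
    have D_fin: "finite (D z)" for z using E(2) by (simp add: D_def)
    have "(\<Sum>z\<in>F. real (alg_multiplicity H z) * w z) \<le> (\<Sum>z\<in>F. \<Sum>e\<in>D z. w z)"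
      using mult w_nonneg by (intro sum_mono) (simp add: D_def mult_right_mono)
    also have "\<dots> \<le> (\<Sum>z\<in>F. \<Sum>e\<in>D z. 8 powr p * cmod (cinner (K e) e) powr p)"
      using F(2) orthonormal_norm[OF E(1)] by (intro sum_mono w_le) (auto simp: D_def)
    also have "\<dots> = (\<Sum>e\<in>(\<Union>z\<in>F. D z). 8 powr p * cmod (cinner (K e) e) powr p)"
    proof (rule sum.UNION_disjoint[symmetric])
      show "\<forall>z\<in>F. \<forall>z'\<in>F. z \<noteq> z' \<longrightarrow> D z \<inter> D z' = {}"
        by (auto simp: D_def)
    qed (use F(1) D_fin in auto)
    also have "\<dots> \<le> (\<Sum>e\<in>E. 8 powr p * cmod (cinner (K e) e) powr p)"
      using E(2) by (intro sum_mono2) (auto simp: D_def)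
    also have "\<dots> \<le> 8 powr p * S"
      unfolding S_def sum_distrib_left[symmetric]
      by (intro mult_left_mono sum_diagonal_powr_le_schatten[OF K(1) E p K(2)]) simp
    finally show ?thesis .
  qed
  have summable: "(\<lambda>z. real (alg_multiplicity H z) * w z) summable_on discrete_spectrum H"
  proof (rule nonneg_bdd_above_summable_on)
    show "bdd_above (sum (\<lambda>z. real (alg_multiplicity H z) * w z) `
        {F. F \<subseteq> discrete_spectrum H \<and> finite F})"
      by (rule bdd_aboveI2[of _ _ "8 powr p * S"]) (use finite_bound in auto)
  qed (simp add: w_nonneg)
  then have "(\<Sum>\<^sub>\<infinity>z\<in>discrete_spectrum H. real (alg_multiplicity H z) * w z) \<le> 8 powr p * S"
    by (rule infsum_le_finite_sums) (use finite_bound in auto)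
  then show ?thesis
    using summable unfolding w_def norm[symmetric] K_def by blast
qed

end
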